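(* Let $r\ge 1$. Let $X$ and $Y$ be connected $C^r$-manifolds of equal dimensions with nonempty boundaries, with $X$ compact. Let $f\colon X\to Y$ be a $C^r$-mapping whose differential $\mathrm{d}f$ is nondegenerate on $X\setminus\partial X$ (that is, $\operatorname{rank}(\mathrm{d}f)=\dim X$ at every point of $X\setminus\partial X$), and suppose that $f$ injectively maps $\partial X$ to $\partial Y$ (that is, $f(\partial X)\subseteq\partial Y$ and $f|_{\partial X}$ is injective). Then $f$ is a homeomorphism of $X$ onto $Y$, and $f|_{X\setminus\partial X}$ is a $C^r$-diffeomorphism of $X\setminus\partial X$ onto $Y\setminus\partial Y$. If moreover the differential $\mathrm{d}f$ is nondegenerate on all of $X$, then $f$ is a $C^r$-diffeomorphism of $X$ onto $Y$.
   Context: An $n$-dimensional topological manifold is a Hausdorff space having a countable cover by open sets each homeomorphic either to $\mathbb{R}^n$ or to $\mathbb{R}^n_+=\{(x_1,\ldots,x_n): x_i\in\mathbb{R},\ x_1\ge 0\}$; its boundary $\partial X$ is the set of points having no neighborhood homeomorphic to $\mathbb{R}^n$. A chart is a homeomorphism of an open domain $U\subset X$ to $\mathbb{R}^n$ or $\mathbb{R}^n_+$; a $C^r$-structure is a cover of $X$ by charts whose transition maps and their inverses are pairwise $C^r$-smooth, two structures being equivalent if their union is also a $C^r$-structure. A $C^r$-manifold is a topological manifold with an equivalence class of $C^r$-structures. A $C^r$-mapping is a continuous mapping that is $C^r$-smooth in charts. A $C^r$-diffeomorphism is a bijective $C^r$-mapping whose inverse is also a $C^r$-mapping. *)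

theory Defs
  imports "HOL-Analysis.Analysis" "HOL-Library.Extended_Nat"
begin

text \<open>The Euclidean space of dimension \<open>n \<ge> 1\<close> is a type \<open>'e\<close> of class \<open>euclidean_space\<close>
  with \<open>DIM('e) = n\<close>. The case \<open>n = 0\<close> is not needed: a 0-manifold has empty boundary.\<close>

section \<open>Smooth maps between subsets of Euclidean spaces\<close>

text \<open>Only meaningful for open \<open>S\<close>: all directional derivatives of order up to \<open>k\<close> exist,
  as Frechet derivatives, and are continuous.\<close>

primrec Ck_on_open :: "nat \<Rightarrow> 'e::euclidean_space set \<Rightarrow> ('e \<Rightarrow> 'f::euclidean_space) \<Rightarrow> bool" where
  "Ck_on_open 0 S f \<longleftrightarrow> continuous_on S f"
| "Ck_on_open (Suc k) S f \<longleftrightarrow> (\<forall>x\<in>S. f differentiable (at x)) \<and>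
     (\<forall>v. Ck_on_open k S (\<lambda>x. frechet_derivative f (at x) v))"

text \<open>\<open>r = \<infinity>\<close> is allowed. On a set that is not open (such as a relatively open subset of the
  half-space) a map is \<open>C\<^sup>r\<close> if near each point it extends to a \<open>C\<^sup>r\<close> map on an open set of the
  ambient space.\<close>

definition Cr_on :: "enat \<Rightarrow> 'e::euclidean_space set \<Rightarrow> ('e \<Rightarrow> 'f::euclidean_space) \<Rightarrow> bool" where
  "Cr_on r S f \<longleftrightarrow> (\<forall>x\<in>S. \<exists>W g. open W \<and> x \<in> W \<and> (\<forall>y\<in>S \<inter> W. g y = f y) \<and>
     (\<forall>k. enat k \<le> r \<longrightarrow> Ck_on_open k W g))"

section \<open>Topological manifolds with boundary\<close>

text \<open>A basis vector, fixed once and for all, whose coordinate plays the role of \<open>x\<^sub>1\<close>.\<close>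

definition e1 :: "'e::euclidean_space" where
  "e1 = (SOME b. b \<in> Basis)"

definition half_space :: "'e::euclidean_space set" where
  "half_space = {x. 0 \<le> x \<bullet> e1}"

definition topological_manifold :: "'e::euclidean_space itself \<Rightarrow> 'a topology \<Rightarrow> bool" where
  "topological_manifold (_ :: 'e itself) X \<longleftrightarrow> Hausdorff_space X \<and>
     (\<exists>\<U>. countable \<U> \<and> \<Union>\<U> = topspace X \<and>
       (\<forall>U\<in>\<U>. openin X U \<and>
          (subtopology X U homeomorphic_space (euclidean :: 'e topology) \<or>
           subtopology X U homeomorphic_space top_of_set (half_space :: 'e set))))"

definition manifold_boundary :: "'e::euclidean_space itself \<Rightarrow> 'a topology \<Rightarrow> 'a set" where
  "manifold_boundary (_ :: 'e itself) X =
     {x \<in> topspace X. \<not> (\<exists>U. openin X U \<and> x \<in> U \<and>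
        subtopology X U homeomorphic_space (euclidean :: 'e topology))}"

definition manifold_interior :: "'e::euclidean_space itself \<Rightarrow> 'a topology \<Rightarrow> 'a set" where
  "manifold_interior T X = topspace X - manifold_boundary T X"

section \<open>Smooth structures\<close>

text \<open>A chart is its domain together with the coordinate map; the values of the coordinate map
  outside the domain are irrelevant.\<close>

type_synonym ('a, 'e) chart = "'a set \<times> ('a \<Rightarrow> 'e)"

definition is_chart :: "'a topology \<Rightarrow> ('a, 'e::euclidean_space) chart \<Rightarrow> bool" where
  "is_chart X = (\<lambda>(U, \<phi>). openin X U \<and>
     (homeomorphic_map (subtopology X U) euclidean \<phi> \<or>
      homeomorphic_map (subtopology X U) (top_of_set half_space) \<phi>))"

text \<open>The inverse of a transition map is the transition map of the swapped pair of charts, so it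
  is covered by quantifying over ordered pairs.\<close>

definition Cr_structure :: "enat \<Rightarrow> 'a topology \<Rightarrow> ('a, 'e::euclidean_space) chart set \<Rightarrow> bool" where
  "Cr_structure r X A \<longleftrightarrow> (\<forall>c\<in>A. is_chart X c) \<and> (\<Union>(U, \<phi>)\<in>A. U) = topspace X \<and>
     (\<forall>(U, \<phi>)\<in>A. \<forall>(V, \<psi>)\<in>A. Cr_on r (\<phi> ` (U \<inter> V)) (\<psi> \<circ> inv_into U \<phi>))"

definition Cr_equivalence ::
    "enat \<Rightarrow> 'a topology \<Rightarrow> (('a, 'e::euclidean_space) chart set \<times> ('a, 'e) chart set) set" where
  "Cr_equivalence r X =
     {(A, B). Cr_structure r X A \<and> Cr_structure r X B \<and> Cr_structure r X (A \<union> B)}"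

text \<open>The second component \<open>\<S>\<close> is an equivalence class of structures; the charts of the manifold
  are the members of \<open>\<Union>\<S>\<close>.\<close>

definition Cr_manifold ::
    "enat \<Rightarrow> 'a topology \<Rightarrow> ('a, 'e::euclidean_space) chart set set \<Rightarrow> bool" where
  "Cr_manifold r X \<S> \<longleftrightarrow> topological_manifold TYPE('e) X \<and>
     \<S> \<in> {A. Cr_structure r X A} // Cr_equivalence r X"

section \<open>Smooth mappings, differentials, diffeomorphisms\<close>

text \<open>The domain and the expression of \<open>f\<close> in a pair of charts. The carrier \<open>W\<close> is the set on
  which \<open>f\<close> is considered.\<close>

definition local_dom ::
    "'a set \<Rightarrow> ('a, 'e) chart \<Rightarrow> ('b, 'f) chart \<Rightarrow> ('a \<Rightarrow> 'b) \<Rightarrow> 'e set" where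
  "local_dom W = (\<lambda>(U, \<phi>) (V, \<psi>) f. \<phi> ` {p \<in> U \<inter> W. f p \<in> V})"

definition local_rep :: "('a, 'e) chart \<Rightarrow> ('b, 'f) chart \<Rightarrow> ('a \<Rightarrow> 'b) \<Rightarrow> 'e \<Rightarrow> 'f" where
  "local_rep = (\<lambda>(U, \<phi>) (V, \<psi>) f. \<psi> \<circ> f \<circ> inv_into U \<phi>)"

text \<open>Besides a whole manifold, \<open>X\<close> (and likewise \<open>Y\<close>) may be an open subspace
  \<open>subtopology M W\<close> of a manifold \<open>(M, \<S>)\<close>. It carries the structure induced from \<open>M\<close>: the charts
  \<open>(U, \<phi>)\<close> of \<open>M\<close> restricted to \<open>U \<inter> W\<close>.\<close>

definition Cr_mapping :: "enat \<Rightarrow> 'a topology \<Rightarrow> ('a, 'e::euclidean_space) chart set set \<Rightarrow>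
    'b topology \<Rightarrow> ('b, 'f::euclidean_space) chart set set \<Rightarrow> ('a \<Rightarrow> 'b) \<Rightarrow> bool" where
  "Cr_mapping r X \<S> Y \<T> f \<longleftrightarrow> continuous_map X Y f \<and>
     (\<forall>c\<in>\<Union>\<S>. \<forall>d\<in>\<Union>\<T>. Cr_on r (local_dom (topspace X) c d f) (local_rep c d f))"

definition Cr_diffeomorphism :: "enat \<Rightarrow> 'a topology \<Rightarrow> ('a, 'e::euclidean_space) chart set set \<Rightarrow>
    'b topology \<Rightarrow> ('b, 'f::euclidean_space) chart set set \<Rightarrow> ('a \<Rightarrow> 'b) \<Rightarrow> bool" where
  "Cr_diffeomorphism r X \<S> Y \<T> f \<longleftrightarrow> bij_betw f (topspace X) (topspace Y) \<and>
     Cr_mapping r X \<S> Y \<T> f \<and> Cr_mapping r Y \<T> X \<S> (inv_into (topspace X) f)"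

text \<open>The differential at \<open>p\<close>, expressed in charts \<open>c\<close> at \<open>p\<close> and \<open>d\<close> at \<open>f p\<close>. The derivative
  is taken within the domain of the local expression, which is relatively open in the space or
  half-space; so it is unique also at boundary points.\<close>

definition differential_in_charts :: "'a topology \<Rightarrow> ('a, 'e::euclidean_space) chart \<Rightarrow>
    ('b, 'f::euclidean_space) chart \<Rightarrow> ('a \<Rightarrow> 'b) \<Rightarrow> 'a \<Rightarrow> 'e \<Rightarrow> 'f" where
  "differential_in_charts X c d f p =
     frechet_derivative (local_rep c d f) (at (snd c p) within local_dom (topspace X) c d f)"

definition nondegenerate_at :: "'a topology \<Rightarrow> ('a, 'e::euclidean_space) chart set set \<Rightarrow>
    ('b, 'e) chart set set \<Rightarrow> ('a \<Rightarrow> 'b) \<Rightarrow> 'a \<Rightarrow> bool" where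
  "nondegenerate_at X \<S> \<T> f p \<longleftrightarrow>
     (\<forall>c\<in>\<Union>\<S>. \<forall>d\<in>\<Union>\<T>. p \<in> fst c \<and> f p \<in> fst d \<longrightarrow>
        dim (range (differential_in_charts X c d f p)) = DIM('e))"

end

theory Submission
  imports Defs
begin

text \<open>
The theorem is mostly topology. On the interior of \<open>X\<close> the inverse function theorem turns
nondegeneracy of the differential into local injectivity, and
\<open>locally_injective_imp_homeomorphic_map\<close> shows that a continuous map from a compact manifold with
nonempty boundary to a connected manifold is a homeomorphism as soon as it is locally injective on
the interior and maps the boundary injectively into the boundary.

By invariance of domain such a map \<open>f\<close> is open on the interior \<open>I\<close> of \<open>X\<close> and sends \<open>I\<close> into
the interior \<open>J\<close> of \<open>Y\<close>. As \<open>f\<close> is also closed (\<open>X\<close> is compact) and only interior points reach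
\<open>J\<close>, the image of \<open>I\<close> is open and closed in \<open>J\<close>, and \<open>J\<close> is connected because \<open>Y\<close> is
(\<open>manifold_interior_clopen\<close>); so \<open>f\<close> maps \<open>I\<close> onto \<open>J\<close>. The set of points of \<open>J\<close> with at least
two preimages is open and closed in \<open>J\<close> as well (\<open>double_points_clopen\<close>), so it is empty or all of
\<open>J\<close>.

The boundary excludes the second case (\<open>single_point_near_boundary\<close>). A boundary point \<open>x\<close> is the
only preimage of \<open>f x\<close>, so by compactness the preimage of a small convex half-ball around
\<open>f x\<close> lies in one chart around \<open>x\<close>. Away from the boundary, \<open>f\<close> is there a proper local
homeomorphism onto a simply connected set, that is, a trivial covering, and hence injective on
every connected set (\<open>proper_local_homeo_inj_on_connected\<close>), in particular on the interior of a
small half-ball around \<open>x\<close>. The points of \<open>J\<close> very close to \<open>f x\<close> have all their preimages in that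
half-ball, hence at most one.

Smoothness of the inverse is a local matter: near a point where the differential is invertible,
the local expression of \<open>f\<close> extends to a \<open>C\<^sup>r\<close> map of open sets with a \<open>C\<^sup>r\<close> local inverse
(\<open>Cr_inverse_function\<close>), and since \<open>f\<close> is a homeomorphism this local inverse extends the local
expression of the inverse of \<open>f\<close> in the same two charts. The argument is the same at interior and at
boundary points, so it proves both claims about diffeomorphisms.
\<close>

section \<open>Calculus of differentiable maps on open sets and the inverse function theorem\<close>

text \<open>Differentiability on an open set only depends on the values there. This allows a derivative to be
replaced by an explicit formula that is valid on the open set only.\<close>

lemma Ck_on_open_cong:
  assumes "open S" "\<And>x. x \<in> S \<Longrightarrow> f x = g x"
  shows "Ck_on_open k S f \<longleftrightarrow> Ck_on_open k S g"
  using assms(2)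
proof (induction k arbitrary: f g)
  case 0
  then show ?case by (simp cong: continuous_on_cong)
next
  case (Suc k)
  have H: "(f has_derivative f') (at x) \<longleftrightarrow> (g has_derivative f') (at x)" if "x \<in> S" for x f'
    using has_derivative_transform_within_open[OF _ assms(1) that, of f f' UNIV g]
      has_derivative_transform_within_open[OF _ assms(1) that, of g f' UNIV f] Suc.prems by auto
  have D: "f differentiable at x \<longleftrightarrow> g differentiable at x" if "x \<in> S" for x
    using H[OF that] unfolding differentiable_def by simp
  have F: "frechet_derivative f (at x) = frechet_derivative g (at x)" if "x \<in> S" for x
    using H[OF that] unfolding frechet_derivative_def by simp
  have "Ck_on_open k S (\<lambda>x. frechet_derivative f (at x) v) \<longleftrightarrow>
      Ck_on_open k S (\<lambda>x. frechet_derivative g (at x) v)" for v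
    by (rule Suc.IH) (simp add: F)
  then show ?case
    using D by simp
qed

lemma Ck_on_open_SucI:
  assumes "open S" "\<And>x. x \<in> S \<Longrightarrow> (f has_derivative f' x) (at x)"
    and "\<And>v. Ck_on_open k S (\<lambda>x. f' x v)"
  shows "Ck_on_open (Suc k) S f"
proof -
  have "frechet_derivative f (at x) = f' x" if "x \<in> S" for x
    using frechet_derivative_at[OF assms(2)[OF that]] by simp
  then have "Ck_on_open k S (\<lambda>x. frechet_derivative f (at x) v)" for v
    using assms(3)[of v] Ck_on_open_cong[OF assms(1), of "\<lambda>x. frechet_derivative f (at x) v" "\<lambda>x. f' x v"]
    by simp
  then show ?thesis
    using assms(2) by (auto simp: differentiable_def)
qed

lemma Ck_on_open_SucD:
  assumes "Ck_on_open (Suc k) S f"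
  shows "\<And>x. x \<in> S \<Longrightarrow> (f has_derivative frechet_derivative f (at x)) (at x)"
    and "\<And>v. Ck_on_open k S (\<lambda>x. frechet_derivative f (at x) v)"
  using assms by (auto simp: frechet_derivative_works)

lemma Ck_on_open_pred: "Ck_on_open (Suc k) S f \<Longrightarrow> Ck_on_open k S f"
proof (induction k arbitrary: f)
  case 0
  then show ?case
    by (simp add: differentiable_imp_continuous_within continuous_at_imp_continuous_on)
next
  case (Suc k)
  have "\<forall>x\<in>S. f differentiable at x" using Suc.prems unfolding Ck_on_open.simps by blast
  moreover have "Ck_on_open k S (\<lambda>x. frechet_derivative f (at x) v)" for v
    by (rule Suc.IH) (use Suc.prems Ck_on_open.simps(2) in blast)
  ultimately show ?case
    unfolding Ck_on_open.simps by blast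
qed

lemma Ck_on_open_imp_continuous_on: "Ck_on_open k S f \<Longrightarrow> continuous_on S f"
proof (induction k)
  case (Suc k)
  then show ?case using Ck_on_open_pred by blast
qed simp

lemma Ck_on_open_subset: "Ck_on_open k S f \<Longrightarrow> T \<subseteq> S \<Longrightarrow> Ck_on_open k T f"
  by (induction k arbitrary: f) (auto intro: continuous_on_subset)

lemma Ck_on_open_const: "open S \<Longrightarrow> Ck_on_open k S (\<lambda>x. c)"
proof (induction k arbitrary: c)
  case (Suc k)
  then show ?case by (intro Ck_on_open_SucI[where f' = "\<lambda>x v. 0"]) (auto intro!: derivative_eq_intros)
qed auto

lemma Ck_on_open_add:
  assumes "open S"
  shows "Ck_on_open k S f \<Longrightarrow> Ck_on_open k S g \<Longrightarrow> Ck_on_open k S (\<lambda>x. f x + g x)"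
proof (induction k arbitrary: f g)
  case 0
  then show ?case by (auto intro: continuous_on_add)
next
  case (Suc k)
  note f = Ck_on_open_SucD[OF Suc.prems(1)] and g = Ck_on_open_SucD[OF Suc.prems(2)]
  show ?case
    by (rule Ck_on_open_SucI[OF assms has_derivative_add[OF f(1) g(1)]])
      (use Suc.IH f(2) g(2) in auto)
qed

lemma Ck_on_open_sum:
  assumes "open S" "\<And>i. i \<in> I \<Longrightarrow> Ck_on_open k S (f i)"
  shows "Ck_on_open k S (\<lambda>x. \<Sum>i\<in>I. f i x)"
  using assms(2)
  by (induction I rule: infinite_finite_induct)
    (auto intro: Ck_on_open_const Ck_on_open_add assms(1))

lemma Ck_on_open_bounded_linear:
  assumes "open S" "bounded_linear L"
  shows "Ck_on_open k S f \<Longrightarrow> Ck_on_open k S (\<lambda>x. L (f x))"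
proof (induction k arbitrary: f)
  case 0
  then show ?case using assms(2) by (auto intro: bounded_linear.continuous_on)
next
  case (Suc k)
  note f = Ck_on_open_SucD[OF Suc.prems]
  show ?case
    by (rule Ck_on_open_SucI[OF assms(1) bounded_linear.has_derivative[OF assms(2) f(1)]])
      (use Suc.IH f(2) in auto)
qed

lemma Ck_on_open_scaleR:
  assumes "open S"
  shows "Ck_on_open k S p \<Longrightarrow> Ck_on_open k S q \<Longrightarrow> Ck_on_open k S (\<lambda>x. p x *\<^sub>R q x)"
proof (induction k arbitrary: p q)
  case 0
  then show ?case by (auto intro: continuous_on_scaleR)
next
  case (Suc k)
  note p = Ck_on_open_SucD[OF Suc.prems(1)] and q = Ck_on_open_SucD[OF Suc.prems(2)]
  show ?case
    by (rule Ck_on_open_SucI[OF assms has_derivative_scaleR[OF p(1) q(1)]])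
      (use Suc.IH p(2) q(2) Suc.prems[THEN Ck_on_open_pred] in \<open>auto intro!: Ck_on_open_add assms\<close>)
qed

text \<open>Expanding the argument in the standard basis writes \<open>N x (u x)\<close> as a finite sum of products of
scalar functions and vector functions of the same class.\<close>

lemma Ck_on_open_apply:
  fixes N :: "'e::euclidean_space \<Rightarrow> 'f::euclidean_space \<Rightarrow> 'g::euclidean_space"
  assumes "open S" "\<And>x. x \<in> S \<Longrightarrow> linear (N x)" "\<And>v. Ck_on_open k S (\<lambda>x. N x v)"
    and "Ck_on_open k S u"
  shows "Ck_on_open k S (\<lambda>x. N x (u x))"
proof -
  have "N x (u x) = (\<Sum>b\<in>Basis. (u x \<bullet> b) *\<^sub>R N x b)" if "x \<in> S" for x
  proof -
    have "N x (u x) = N x (\<Sum>b\<in>Basis. (u x \<bullet> b) *\<^sub>R b)"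
      by (simp add: euclidean_representation)
    also have "\<dots> = (\<Sum>b\<in>Basis. (u x \<bullet> b) *\<^sub>R N x b)"
      using assms(2)[OF that] by (simp add: linear_sum linear_cmul)
    finally show ?thesis .
  qed
  moreover have "Ck_on_open k S (\<lambda>x. \<Sum>b\<in>Basis. (u x \<bullet> b) *\<^sub>R N x b)"
    by (intro Ck_on_open_sum Ck_on_open_scaleR assms
        Ck_on_open_bounded_linear[where L = "\<lambda>z. z \<bullet> _"] bounded_linear_inner_left)
  ultimately show ?thesis
    using Ck_on_open_cong[OF assms(1), of "\<lambda>x. N x (u x)"
        "\<lambda>x. \<Sum>b\<in>Basis. (u x \<bullet> b) *\<^sub>R N x b"] by blast
qed

text \<open>By the chain rule a directional derivative of the composition is the derivative of \<open>g\<close> along \<open>h\<close>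
applied to a directional derivative of \<open>h\<close>, both of which are one class less smooth, so
induction on the class applies.\<close>

lemma Ck_on_open_compose:
  fixes h :: "'e::euclidean_space \<Rightarrow> 'f::euclidean_space"
  assumes "open S" "open T" "h ` S \<subseteq> T"
  shows "Ck_on_open k T g \<Longrightarrow> Ck_on_open k S h \<Longrightarrow> Ck_on_open k S (\<lambda>x. g (h x))"
proof (induction k arbitrary: g)
  case 0
  then show ?case using assms by (auto intro: continuous_on_compose2)
next
  case (Suc k)
  note g = Ck_on_open_SucD[OF Suc.prems(1)] and h = Ck_on_open_SucD[OF Suc.prems(2)]
  have hT: "h x \<in> T" if "x \<in> S" for x using assms that by auto
  have D: "((\<lambda>x. g (h x)) has_derivative
     (\<lambda>v. frechet_derivative g (at (h x)) (frechet_derivative h (at x) v))) (at x)"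
    if "x \<in> S" for x
    using diff_chain_at[OF h(1)[OF that] g(1)[OF hT[OF that]]] by (simp add: o_def)
  show ?case
  proof (rule Ck_on_open_SucI[OF assms(1) D])
    fix v
    show "Ck_on_open k S (\<lambda>x. frechet_derivative g (at (h x)) (frechet_derivative h (at x) v))"
    proof (rule Ck_on_open_apply[OF assms(1), where N = "\<lambda>x. frechet_derivative g (at (h x))"
          and u = "\<lambda>x. frechet_derivative h (at x) v"])
      show "linear (frechet_derivative g (at (h x)))" if "x \<in> S" for x
        using g(1)[OF hT[OF that]] has_derivative_linear by blast
      show "Ck_on_open k S (\<lambda>x. frechet_derivative g (at (h x)) w)" for w
        using Suc.IH[OF g(2) Ck_on_open_pred[OF Suc.prems(2)]] .
      show "Ck_on_open k S (\<lambda>x. frechet_derivative h (at x) v)"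
        by (rule h(2))
    qed
  qed
qed

text \<open>A product rule in which the scalar factor is merely continuous, at the price that the other factor
vanishes at the point. It serves to differentiate the inverse of an operator, whose
differentiability is not known beforehand.\<close>

lemma has_derivative_scaleR_at_zero:
  fixes p :: "'e::real_normed_vector \<Rightarrow> real" and q :: "'e \<Rightarrow> 'f::real_normed_vector"
  assumes p: "isCont p x" and q: "(q has_derivative q') (at x)" "q x = 0"
  shows "((\<lambda>y. p y *\<^sub>R q y) has_derivative (\<lambda>v. p x *\<^sub>R q' v)) (at x)"
  unfolding has_derivative_within
proof (intro conjI)
  have bl: "bounded_linear q'" using q(1) has_derivative_bounded_linear by blast
  then show "bounded_linear (\<lambda>v. p x *\<^sub>R q' v)" by (rule bounded_linear_scaleR_right[THEN bounded_linear_compose])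
  have 1: "((\<lambda>y. (1 / norm (y - x)) *\<^sub>R (q y - (q x + q' (y - x)))) \<longlongrightarrow> 0) (at x)"
    using q(1) by (simp add: has_derivative_within)
  have 2: "((\<lambda>y. p y - p x) \<longlongrightarrow> 0) (at x)"
    using p LIM_zero isCont_def by blast
  obtain K where K: "\<And>v. norm (q' v) \<le> K * norm v"
    using bounded_linear.nonneg_bounded[OF bl] by (metis mult.commute)
  have 3: "((\<lambda>y. (p y - p x) *\<^sub>R ((1 / norm (y - x)) *\<^sub>R q' (y - x))) \<longlongrightarrow> 0) (at x)"
  proof (rule Lim_null_comparison)
    show "((\<lambda>y. \<bar>p y - p x\<bar> * K) \<longlongrightarrow> 0) (at x)"
      using tendsto_mult_left_zero[OF tendsto_rabs_zero[OF 2]] .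
    have "norm ((1 / norm (y - x)) *\<^sub>R q' (y - x)) \<le> K" if "y \<noteq> x" for y
      using K[of "y - x"] that by (simp add: field_simps)
    then have "norm ((p y - p x) *\<^sub>R ((1 / norm (y - x)) *\<^sub>R q' (y - x))) \<le> \<bar>p y - p x\<bar> * K"
      if "y \<noteq> x" for y
      using that unfolding norm_scaleR[of "p _ - p x"] real_norm_def by (intro mult_left_mono) auto
    then show "\<forall>\<^sub>F y in at x. norm ((p y - p x) *\<^sub>R ((1 / norm (y - x)) *\<^sub>R q' (y - x))) \<le> \<bar>p y - p x\<bar> * K"
      by (rule eventually_mono[OF eventually_neq_at_within])
  qed
  have "((\<lambda>y. p y *\<^sub>R ((1 / norm (y - x)) *\<^sub>R (q y - (q x + q' (y - x))))
      + (p y - p x) *\<^sub>R ((1 / norm (y - x)) *\<^sub>R q' (y - x))) \<longlongrightarrow> p x *\<^sub>R 0 + 0) (at x)"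
    by (intro tendsto_add tendsto_scaleR 1 3 p[unfolded isCont_def])
  then show "((\<lambda>y. (1 / norm (y - x)) *\<^sub>R (p y *\<^sub>R q y - (p x *\<^sub>R q x + p x *\<^sub>R q' (y - x)))) \<longlongrightarrow> 0) (at x)"
    using q(2) by (simp add: algebra_simps diff_divide_distrib)
qed

text \<open>Write \<open>u x\<close> for the solution of \<open>M x (u x) = v\<close>. Then \<open>u x - u a\<close> is \<open>(M a)\<inverse>\<close> applied to
\<open>(M a - M x) (u x)\<close>, which first bounds \<open>u x\<close> near \<open>a\<close> and then shows that it tends to \<open>u a\<close>.\<close>

lemma continuous_on_inverse_operator:
  fixes M :: "'e::euclidean_space \<Rightarrow> 'f::euclidean_space \<Rightarrow> 'f"
  assumes lin: "\<And>x. x \<in> S \<Longrightarrow> linear (M x)" and bij: "\<And>x. x \<in> S \<Longrightarrow> bij (M x)"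
    and cont: "\<And>b. continuous_on S (\<lambda>x. M x b)"
  shows "continuous_on S (\<lambda>x. inv (M x) v)"
  unfolding continuous_on_def
proof
  fix a assume a: "a \<in> S"
  define u where "u x = inv (M x) v" for x
  have Mu: "M x (u x) = v" if "x \<in> S" for x
    unfolding u_def using bij[OF that] by (simp add: bij_is_surj surj_f_inv_f)
  have lina: "linear (M a)" "linear (inv (M a))"
    using a lin bij by (auto simp: bij_is_inj bij_is_surj intro!: inj_linear_imp_inv_linear)
  obtain C where C: "C > 0" "\<And>w. norm (inv (M a) w) \<le> C * norm w"
    using linear_bounded_pos[OF lina(2)] by auto
  define e where "e x = (\<Sum>b\<in>Basis. norm (M a b - M x b))" for x
  have e: "norm (M a w - M x w) \<le> e x * norm w" if "x \<in> S" for x w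
  proof -
    have "M a w - M x w = M a (\<Sum>b\<in>Basis. (w \<bullet> b) *\<^sub>R b) - M x (\<Sum>b\<in>Basis. (w \<bullet> b) *\<^sub>R b)"
      by (simp add: euclidean_representation)
    also have "\<dots> = (\<Sum>b\<in>Basis. (w \<bullet> b) *\<^sub>R (M a b - M x b))"
      using lin[OF that] lina(1) by (simp add: linear_sum linear_cmul sum_subtractf algebra_simps)
    also have "norm \<dots> \<le> (\<Sum>b\<in>Basis. norm w * norm (M a b - M x b))"
      by (rule sum_norm_le) (auto intro!: mult_right_mono Basis_le_norm)
    finally show ?thesis by (simp add: e_def sum_distrib_left mult.commute)
  qed
  have diff: "norm (u x - u a) \<le> C * e x * norm (u x)" if "x \<in> S" for x
  proof -
    have "M a (u x - u a) = M a (u x) - M x (u x)"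
      using Mu[OF that] Mu[OF a] lina(1) by (simp add: linear_diff)
    then have "u x - u a = inv (M a) (M a (u x) - M x (u x))"
      using bij[OF a] by (metis bij_inv_eq_iff)
    then have "norm (u x - u a) \<le> C * norm (M a (u x) - M x (u x))"
      using C(2) by metis
    also have "\<dots> \<le> C * (e x * norm (u x))"
      using C(1) e[OF that] by (intro mult_left_mono) auto
    finally show ?thesis by (simp add: mult.assoc)
  qed
  have "(e \<longlongrightarrow> (\<Sum>b\<in>(Basis::'f set). norm (M a b - M a b))) (at a within S)"
    unfolding e_def using cont a by (intro tendsto_intros) (auto simp: continuous_on_def)
  then have e0: "(e \<longlongrightarrow> 0) (at a within S)" by simp
  have "((\<lambda>x. C * e x) \<longlongrightarrow> 0) (at a within S)"
    using tendsto_mult_right_zero[OF e0] .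
  then have half: "\<forall>\<^sub>F x in at a within S. C * e x < 1 / 2"
    by (rule order_tendstoD) auto
  have "\<forall>\<^sub>F x in at a within S. x \<in> S" by (simp add: eventually_at_filter)
  with half have "\<forall>\<^sub>F x in at a within S. norm (u x - u a) \<le> 2 * (C * e x) * norm (u a)"
  proof eventually_elim
    case (elim x)
    \<comment> \<open>near \<open>a\<close> the factor \<open>C * e x\<close> is below one half, and the term with \<open>u x\<close> can be absorbed\<close>
    have nn: "0 \<le> C * e x" using C(1) by (simp add: e_def sum_nonneg)
    have "C * e x * norm (u x) \<le> 1 / 2 * norm (u x)"
      using elim by (intro mult_right_mono) auto
    then have "norm (u x) \<le> 2 * norm (u a)"
      using diff[OF elim(2)] norm_triangle_ineq2[of "u x" "u a"] by linarith
    then have "C * e x * norm (u x) \<le> C * e x * (2 * norm (u a))"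
      using nn by (intro mult_left_mono) auto
    with diff[OF elim(2)] show ?case by simp
  qed
  moreover have "((\<lambda>x. 2 * (C * e x) * norm (u a)) \<longlongrightarrow> 0) (at a within S)"
    using tendsto_mult_left_zero[OF tendsto_mult_right_zero[OF tendsto_mult_right_zero[OF e0]]] .
  ultimately have "((\<lambda>x. u x - u a) \<longlongrightarrow> 0) (at a within S)"
    by (rule Lim_null_comparison)
  then show "((\<lambda>x. inv (M x) v) \<longlongrightarrow> inv (M a) v) (at a within S)"
    unfolding u_def using Lim_null by blast
qed

text \<open>With \<open>u x\<close> the solution of \<open>M x (u x) = v\<close>, the identity
\<open>u y = u x - (M x)\<inverse> ((M y - M x) (u y))\<close> expresses \<open>u\<close> through products of the coordinates of \<open>u\<close>,
which are continuous, and the functions \<open>M y b - M x b\<close>, which are differentiable and vanish at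
\<open>y = x\<close>.\<close>

lemma has_derivative_inverse_operator:
  fixes M :: "'e::euclidean_space \<Rightarrow> 'f::euclidean_space \<Rightarrow> 'f"
  assumes "open S" "x \<in> S"
    and lin: "\<And>x. x \<in> S \<Longrightarrow> linear (M x)" and bij: "\<And>x. x \<in> S \<Longrightarrow> bij (M x)"
    and cont: "\<And>b. continuous_on S (\<lambda>x. M x b)"
    and der: "\<And>b. ((\<lambda>x. M x b) has_derivative N b) (at x)"
  shows "((\<lambda>x. inv (M x) v) has_derivative
     (\<lambda>w. - inv (M x) (\<Sum>b\<in>Basis. (inv (M x) v \<bullet> b) *\<^sub>R N b w))) (at x)"
proof -
  define u where "u x = inv (M x) v" for x
  have Mu: "M x (u x) = v" if "x \<in> S" for x
    unfolding u_def using bij[OF that] by (simp add: bij_is_surj surj_f_inv_f)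
  have linx: "linear (M x)" "linear (inv (M x))"
    using assms(2) lin bij by (auto simp: bij_is_inj bij_is_surj intro!: inj_linear_imp_inv_linear)
  have "isCont u x"
    using continuous_on_inverse_operator[of S M v, OF lin bij cont] assms(1,2)
    by (simp add: u_def[abs_def] continuous_on_eq_continuous_at)
  then have cu: "isCont (\<lambda>y. u y \<bullet> b) x" for b
    by (intro continuous_intros)
  have N0: "((\<lambda>y. M y b - M x b) has_derivative N b) (at x)" for b
    using has_derivative_diff[OF der[of b] has_derivative_const[of "M x b"]] by simp
  have "((\<lambda>y. (u y \<bullet> b) *\<^sub>R (M y b - M x b)) has_derivative (\<lambda>w. (u x \<bullet> b) *\<^sub>R N b w)) (at x)" for b
    by (rule has_derivative_scaleR_at_zero[OF cu N0]) simp
  then have "((\<lambda>y. \<Sum>b\<in>Basis. (u y \<bullet> b) *\<^sub>R (M y b - M x b)) has_derivative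
       (\<lambda>w. \<Sum>b\<in>Basis. (u x \<bullet> b) *\<^sub>R N b w)) (at x)"
    by (rule has_derivative_sum)
  from bounded_linear.has_derivative[OF linear_conv_bounded_linear[THEN iffD1, OF linx(2)] this]
  have "((\<lambda>y. u x - inv (M x) (\<Sum>b\<in>Basis. (u y \<bullet> b) *\<^sub>R (M y b - M x b))) has_derivative
       (\<lambda>w. 0 - inv (M x) (\<Sum>b\<in>Basis. (u x \<bullet> b) *\<^sub>R N b w))) (at x)"
    by (intro has_derivative_diff has_derivative_const)
  then have "(u has_derivative (\<lambda>w. 0 - inv (M x) (\<Sum>b\<in>Basis. (u x \<bullet> b) *\<^sub>R N b w))) (at x)"
  proof (rule has_derivative_transform_within_open[OF _ assms(1,2)])
    fix y assume y: "y \<in> S"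
    have "(\<Sum>b\<in>Basis. (u y \<bullet> b) *\<^sub>R (M y b - M x b)) =
       M y (\<Sum>b\<in>Basis. (u y \<bullet> b) *\<^sub>R b) - M x (\<Sum>b\<in>Basis. (u y \<bullet> b) *\<^sub>R b)"
      using lin[OF y] linx(1) by (simp add: linear_sum linear_cmul sum_subtractf algebra_simps)
    also have "\<dots> = M x (u x - u y)"
      using Mu[OF y] Mu[OF assms(2)] linx(1) by (simp add: euclidean_representation linear_diff)
    finally show "u x - inv (M x) (\<Sum>b\<in>Basis. (u y \<bullet> b) *\<^sub>R (M y b - M x b)) = u y"
      using bij[OF assms(2)] by (simp add: bij_is_inj inv_f_f)
  qed
  then show ?thesis unfolding u_def[abs_def] by simp
qed

text \<open>The derivative of the inverse operator consists of the inverse operator itself and derivatives of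
\<open>M\<close>, so its class can be raised one step at a time.\<close>

lemma Ck_on_open_inverse_operator:
  fixes M :: "'e::euclidean_space \<Rightarrow> 'f::euclidean_space \<Rightarrow> 'f"
  assumes S: "open S"
    and lin: "\<And>x. x \<in> S \<Longrightarrow> linear (M x)" and bij: "\<And>x. x \<in> S \<Longrightarrow> bij (M x)"
  shows "(\<And>b. Ck_on_open k S (\<lambda>x. M x b)) \<Longrightarrow> Ck_on_open k S (\<lambda>x. inv (M x) v)"
proof (induction k arbitrary: v)
  case 0
  then show ?case unfolding Ck_on_open.simps by (intro continuous_on_inverse_operator lin bij)
next
  case (Suc k)
  have linv: "linear (inv (M x))" if "x \<in> S" for x
    using that lin bij by (auto simp: bij_is_inj bij_is_surj intro!: inj_linear_imp_inv_linear)
  note D = Ck_on_open_SucD[OF Suc.prems]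
  have IH: "Ck_on_open k S (\<lambda>x. inv (M x) w)" for w
    by (rule Suc.IH) (rule Ck_on_open_pred[OF Suc.prems])
  have "Ck_on_open k S (\<lambda>x. inv (M x)
      (\<Sum>b\<in>Basis. (inv (M x) v \<bullet> b) *\<^sub>R frechet_derivative (\<lambda>x. M x b) (at x) w))" for w
    by (rule Ck_on_open_apply[OF S linv IH])
      (auto intro!: Ck_on_open_sum Ck_on_open_scaleR S D(2) IH
        Ck_on_open_bounded_linear[where L = "\<lambda>z. z \<bullet> _"] bounded_linear_inner_left)
  then have "Ck_on_open k S (\<lambda>x. - inv (M x)
      (\<Sum>b\<in>Basis. (inv (M x) v \<bullet> b) *\<^sub>R frechet_derivative (\<lambda>x. M x b) (at x) w))" for w
    by (intro Ck_on_open_bounded_linear[where L = uminus] S bounded_linear_minus bounded_linear_ident)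
  note Ck = this
  have der: "((\<lambda>x. inv (M x) v) has_derivative (\<lambda>w. - inv (M x)
      (\<Sum>b\<in>Basis. (inv (M x) v \<bullet> b) *\<^sub>R frechet_derivative (\<lambda>x. M x b) (at x) w))) (at x)"
    if "x \<in> S" for x
    using has_derivative_inverse_operator[OF S that lin bij Ck_on_open_imp_continuous_on[OF Suc.prems]
        D(1)[OF that], of v] by simp
  show ?case
    by (rule Ck_on_open_SucI[OF S der Ck])
qed

text \<open>The derivative of the inverse \<open>h\<close> is the inverse of the derivative of \<open>g\<close> along \<open>h\<close>: if \<open>h\<close> is
\<open>C\<^sup>k\<close> and \<open>g\<close> is one class smoother, this makes the derivative of \<open>h\<close> a \<open>C\<^sup>k\<close> map.\<close>

lemma Ck_on_open_local_inverse:
  fixes g :: "'e::euclidean_space \<Rightarrow> 'e"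
  assumes "open U" "open V" "homeomorphism U V g h" "Ck_on_open k U g"
    and der: "\<And>y. y \<in> V \<Longrightarrow> (h has_derivative inv (frechet_derivative g (at (h y)))) (at y)"
    and bij: "\<And>y. y \<in> V \<Longrightarrow> bij (frechet_derivative g (at (h y)))"
  shows "Ck_on_open k V h"
  using assms(4)
proof (induction k)
  case 0
  then show ?case using assms(3) homeomorphism_cont2 by auto
next
  case (Suc k)
  have hV: "h ` V \<subseteq> U" using assms(3) homeomorphism_image2 by blast
  note D = Ck_on_open_SucD[OF Suc.prems]
  have h: "Ck_on_open k V h"
    by (rule Suc.IH[OF Ck_on_open_pred[OF Suc.prems]])
  show ?case
  proof (rule Ck_on_open_SucI[OF assms(2) der])
    fix v
    show "Ck_on_open k V (\<lambda>y. inv (frechet_derivative g (at (h y))) v)"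
    proof (rule Ck_on_open_inverse_operator[OF assms(2) _ bij])
      show "linear (frechet_derivative g (at (h y)))" if "y \<in> V" for y
        using D(1)[of "h y"] hV that has_derivative_linear by blast
      show "Ck_on_open k V (\<lambda>y. frechet_derivative g (at (h y)) b)" for b
        by (rule Ck_on_open_compose[OF assms(2,1) hV D(2) h])
    qed
  qed
qed

text \<open>The classical theorem for \<open>C\<^sup>1\<close> maps, followed by a bootstrap through the formula for the
derivative of the local inverse (\<open>Ck_on_open_local_inverse\<close>).\<close>

proposition Cr_inverse_function:
  fixes g :: "'e::euclidean_space \<Rightarrow> 'e"
  assumes "1 \<le> r" "open W" "a \<in> W" and Ck: "\<And>k. enat k \<le> r \<Longrightarrow> Ck_on_open k W g"
    and surj: "surj (frechet_derivative g (at a))"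
  obtains U V h where "open U" "U \<subseteq> W" "a \<in> U" "open V" "homeomorphism U V g h"
    "\<forall>k. enat k \<le> r \<longrightarrow> Ck_on_open k V h"
proof -
  have C1: "Ck_on_open (Suc 0) W g"
    using Ck[of 1] assms(1) by (simp add: one_enat_def)
  note D = Ck_on_open_SucD[OF C1]
  define g' where "g' x = Blinfun (frechet_derivative g (at x))" for x
  have g': "blinfun_apply (g' x) = frechet_derivative g (at x)" if "x \<in> W" for x
    unfolding g'_def using D(1)[OF that] by (intro bounded_linear_Blinfun_apply has_derivative_bounded_linear)
  have lin: "linear (frechet_derivative g (at a))"
    using D(1)[OF assms(3)] has_derivative_linear by blast
  then have bij: "bij (frechet_derivative g (at a))"
    using surj linear_surjective_imp_injective by (auto simp: bij_def)
  have linv: "linear (inv (frechet_derivative g (at a)))"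
    using lin bij by (auto simp: bij_is_inj bij_is_surj intro!: inj_linear_imp_inv_linear)
  have inv: "Blinfun (inv (frechet_derivative g (at a))) o\<^sub>L g' a = id_blinfun"
    using bij linv g'[OF assms(3)]
    by (intro blinfun_eqI) (simp add: bounded_linear_Blinfun_apply linear_conv_bounded_linear bij_is_inj inv_f_f)
  have cont: "continuous_on W g'"
  proof (rule continuous_on_blinfun_componentwise)
    fix i :: 'e
    show "continuous_on W (\<lambda>x. blinfun_apply (g' x) i)"
      using D(2)[of i] g' by (simp cong: continuous_on_cong)
  qed
  have der: "(g has_derivative blinfun_apply (g' x)) (at x)" if "x \<in> W" for x
    using D(1)[OF that] g'[OF that] by simp
  show thesis
  proof (rule inverse_function_theorem[OF assms(2) der cont assms(3) inv], goal_cases)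
    case (2 U V h h')
    have hW: "h y \<in> W" if "y \<in> V" for y
      using 2(2) homeomorphism_image2[OF 2(6)] that by blast
    have "Ck_on_open k V h" if "enat k \<le> r" for k
    proof (rule Ck_on_open_local_inverse[OF 2(1,4,6)])
      show "Ck_on_open k U g" using Ck[OF that] 2(2) by (rule Ck_on_open_subset)
      fix y assume y: "y \<in> V"
      show "(h has_derivative inv (frechet_derivative g (at (h y)))) (at y)"
        using 2(7)[OF y] 2(8)[OF y] g'[OF hW[OF y]] by simp
      show "bij (frechet_derivative g (at (h y)))"
        using 2(9)[OF y] g'[OF hW[OF y]] by simp
    qed
    then show thesis
      using that[OF 2(1-4,6)] by blast
  qed
qed

section \<open>Proper local homeomorphisms onto convex sets\<close>

lemma locally_inj_imp_open_map:
  fixes g :: "'a::euclidean_space \<Rightarrow> 'a"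
  assumes "open P" and cont: "continuous_on P g"
    and inj: "\<And>x. x \<in> P \<Longrightarrow> \<exists>N. open N \<and> x \<in> N \<and> inj_on g N"
    and "open A" "A \<subseteq> P"
  shows "open (g ` A)"
  unfolding open_subopen[of "g ` A"]
proof
  fix y assume "y \<in> g ` A"
  then obtain x where x: "x \<in> A" "y = g x" by blast
  then obtain N where N: "open N" "x \<in> N" "inj_on g N"
    using inj[of x] assms(5) by blast
  have "open (g ` (N \<inter> A))"
    using N assms(4,5) by (intro invariance_of_domain)
      (auto intro: continuous_on_subset[OF cont] inj_on_subset)
  then show "\<exists>T. open T \<and> y \<in> T \<and> T \<subseteq> g ` A"
    using x N(2) by (intro exI[of _ "g ` (N \<inter> A)"]) auto
qed

text \<open>A fibre is compact and, by local injectivity, discrete, hence finite. Small disjoint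
neighbourhoods of its points cover all preimages of a sufficiently small neighbourhood of the base
point, because \<open>g\<close> is closed; intersecting with the preimage of the common part of their images
gives the sheets.\<close>

lemma proper_local_homeo_imp_covering_space:
  fixes g :: "'a::euclidean_space \<Rightarrow> 'a"
  assumes "open P" "connected Q" "P \<noteq> {}"
    and proper: "proper_map (top_of_set P) (top_of_set Q) g"
    and cont: "continuous_on P g"
    and inj: "\<And>x. x \<in> P \<Longrightarrow> \<exists>N. open N \<and> x \<in> N \<and> inj_on g N"
  shows "covering_space P g Q"
proof -
  have gPQ: "g ` P \<subseteq> Q"
    using proper_map_imp_subset_topspace[OF proper] by auto
  have closed: "closedin (top_of_set Q) (g ` K)" if "closedin (top_of_set P) K" for K
    using proper that by (auto simp: proper_map_def closed_map_def)
  have oQ: "openin (top_of_set Q) (g ` N)" if "open N" "N \<subseteq> P" for N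
    using locally_inj_imp_open_map[OF assms(1) cont inj that] that(2) gPQ by (intro open_subset) auto
  have surj: "g ` P = Q"
  proof -
    have "openin (top_of_set Q) (g ` P)" "closedin (top_of_set Q) (g ` P)"
      using oQ[OF assms(1)] closed[of P] by auto
    then show ?thesis
      using assms(2,3) unfolding connected_clopen by blast
  qed
  show ?thesis
  proof (rule covering_spaceI[OF cont surj])
    fix y assume y: "y \<in> Q"
    define F where "F = {x\<in>P. g x = y}"
    have "compactin (top_of_set P) F"
      using proper y by (auto simp: proper_map_def F_def)
    then have cF: "compact F" by (simp add: compactin_subtopology)
    obtain N0 where N0: "\<And>x. x \<in> P \<Longrightarrow> open (N0 x)" "\<And>x. x \<in> P \<Longrightarrow> x \<in> N0 x"
       "\<And>x. x \<in> P \<Longrightarrow> inj_on g (N0 x)"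
      using inj by metis
    have finF: "finite F"
    proof (rule finite_not_islimpt_in_compact[OF cF, of F, simplified])
      fix x assume x: "x \<in> F"
      then have xP: "x \<in> P" "g x = y" by (auto simp: F_def)
      show "\<not> x islimpt F"
      proof
        assume "x islimpt F"
        then obtain z where "z \<in> F" "z \<in> N0 x" "z \<noteq> x"
          using N0(1,2)[OF xP(1)] by (auto simp: islimpt_def)
        then show False
          using N0(2,3)[OF xP(1)] xP by (auto simp: F_def inj_on_def)
      qed
    qed
    obtain e where e: "e > 0" "\<And>x z. x \<in> F \<Longrightarrow> z \<in> F \<Longrightarrow> x \<noteq> z \<Longrightarrow> e \<le> dist x z"
    proof -
      have "\<exists>d>0. \<forall>z\<in>F. z \<noteq> x \<longrightarrow> d \<le> dist x z" for x
        using finite_set_avoid[OF finF] by blast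
      then obtain d where d: "\<And>x. d x > 0" "\<And>x z. z \<in> F \<Longrightarrow> z \<noteq> x \<Longrightarrow> d x \<le> dist x z"
        by metis
      show ?thesis
      proof (rule that[of "Min (insert 1 (d ` F))"])
        show "Min (insert 1 (d ` F)) > 0" using finF d(1) by auto
        fix x z assume xz: "x \<in> F" "z \<in> F" "x \<noteq> z"
        have "Min (insert 1 (d ` F)) \<le> d x" using finF xz by (intro Min_le) auto
        then show "Min (insert 1 (d ` F)) \<le> dist x z" using d(2)[of z x] xz by auto
      qed
    qed
    define N where "N x = N0 x \<inter> ball x (e/2) \<inter> P" for x
    have FP: "F \<subseteq> P" by (auto simp: F_def)
    have N: "open (N x)" "x \<in> N x" "inj_on g (N x)" "N x \<subseteq> P" if "x \<in> F" for x
      using N0[of x] FP that e(1) assms(1) inj_on_subset[of g "N0 x" "N x"] by (auto simp: N_def)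
    have disj: "N x \<inter> N z = {}" if "x \<in> F" "z \<in> F" "x \<noteq> z" for x z
    proof -
      have False if "w \<in> N x" "w \<in> N z" for w
        using that e(2)[OF \<open>x \<in> F\<close> \<open>z \<in> F\<close> \<open>x \<noteq> z\<close>] dist_triangle2[of x z w]
        by (auto simp: N_def dist_commute)
      then show ?thesis by blast
    qed
    \<comment> \<open>removing the closed image of \<open>R\<close> leaves points all of whose preimages lie in the chosen neighbourhoods\<close>
    define R where "R = P - (\<Union>x\<in>F. N x)"
    define T where "T = (Q - g ` R) \<inter> (\<Inter>x\<in>F. g ` N x)"
    have "closedin (top_of_set P) R"
      unfolding R_def Diff_eq using N(1) by (intro closedin_closed_Int closed_Compl open_UN) auto
    then have oT0: "openin (top_of_set Q) (Q - g ` R)"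
      using closed[of R] by (intro openin_diff) auto
    have "openin (top_of_set Q) T"
    proof (cases "F = {}")
      case True
      then show ?thesis using oT0 by (simp add: T_def)
    next
      case False
      have "openin (top_of_set Q) (\<Inter>x\<in>F. g ` N x)"
        by (rule openin_Inter) (use finF False N(1,4) oQ in auto)
      with oT0 show ?thesis unfolding T_def by (rule openin_Int)
    qed
    moreover have "y \<in> T"
    proof -
      have "g z \<noteq> y" if "z \<in> R" for z
        using that N(2)[of z] by (auto simp: R_def F_def)
      moreover have "y \<in> g ` N x" if "x \<in> F" for x
        using N(2)[OF that] that by (auto simp: F_def)
      ultimately show ?thesis using y by (auto simp: T_def)
    qed
    moreover have "\<exists>v. \<Union>v = P \<inter> g -` T \<and> (\<forall>u\<in>v. openin (top_of_set P) u) \<and>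
        pairwise disjnt v \<and> (\<forall>u\<in>v. \<exists>q. homeomorphism u T g q)"
    proof -
      define v where "v = (\<lambda>x. N x \<inter> g -` T) ` F"
      have "\<Union>v = P \<inter> g -` T"
      proof
        show "P \<inter> g -` T \<subseteq> \<Union>v"
        proof
          fix z assume z: "z \<in> P \<inter> g -` T"
          then have "z \<notin> R" by (auto simp: T_def)
          then obtain x where "x \<in> F" "z \<in> N x" using z by (auto simp: R_def)
          then show "z \<in> \<Union>v" using z by (auto simp: v_def)
        qed
      qed (use N(4) in \<open>auto simp: v_def\<close>)
      moreover have "pairwise disjnt v"
        using disj by (auto simp: pairwise_def disjnt_def v_def)
      moreover have "openin (top_of_set P) u \<and> (\<exists>q. homeomorphism u T g q)" if u: "u \<in> v" for u
      proof -
        obtain x where x: "x \<in> F" "u = N x \<inter> g -` T" using u by (auto simp: v_def)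
        obtain T' where T': "open T'" "T = Q \<inter> T'"
          using \<open>openin (top_of_set Q) T\<close> by (auto simp: openin_open)
        have "N x \<subseteq> g -` Q" using N(4)[OF x(1)] gPQ by blast
        then have u': "u = N x \<inter> g -` T'"
          unfolding x(2) T'(2) by blast
        have ou: "open u"
          using continuous_open_preimage[OF continuous_on_subset[OF cont N(4)[OF x(1)]] N(1)[OF x(1)] T'(1)]
          by (simp add: u')
        have uP: "u \<subseteq> P" using x N(4) by auto
        have injg: "inj_on g u" using N(3)[OF x(1)] x(2) by (auto intro: inj_on_subset)
        have "T \<subseteq> g ` N x" using x(1) by (auto simp: T_def)
        then have im: "g ` u = T" unfolding x(2) by blast
        obtain q where "homeomorphism u (g ` u) g q"
          by (rule invariance_of_domain_homeomorphism[OF ou continuous_on_subset[OF cont uP] order_refl injg])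
        then show ?thesis
          using open_subset[OF uP ou] unfolding im by blast
      qed
      ultimately show ?thesis by (intro exI[of _ v]) simp
    qed
    ultimately show "\<exists>T. y \<in> T \<and> openin (top_of_set Q) T \<and>
        (\<exists>v. \<Union>v = P \<inter> g -` T \<and> (\<forall>u\<in>v. openin (top_of_set P) u) \<and>
        pairwise disjnt v \<and> (\<forall>u\<in>v. \<exists>q. homeomorphism u T g q))"
      by (intro exI[of _ T] conjI)
  qed
qed

text \<open>Over the simply connected set \<open>Q\<close> the identity lifts to a section \<open>s\<close> of \<open>g\<close> through any given
point \<open>a\<close> of \<open>B\<close>. On the connected set \<open>B\<close> both \<open>s \<circ> g\<close> and the identity lift \<open>g\<close>, and they agree at
\<open>a\<close>; so they agree on \<open>B\<close>.\<close>

lemma proper_local_homeo_inj_on_connected: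
  fixes g :: "'a::euclidean_space \<Rightarrow> 'a"
  assumes "open P" "open Q" "convex Q"
    and proper: "proper_map (top_of_set P) (top_of_set Q) g"
    and cont: "continuous_on P g"
    and inj: "\<And>x. x \<in> P \<Longrightarrow> \<exists>N. open N \<and> x \<in> N \<and> inj_on g N"
    and B: "connected B" "B \<subseteq> P"
  shows "inj_on g B"
proof
  fix a b assume ab: "a \<in> B" "b \<in> B" "g a = g b"
  have "P \<noteq> {}" using ab B by blast
  note cov = proper_local_homeo_imp_covering_space[OF assms(1) convex_connected[OF assms(3)] this proper cont inj]
  have gPQ: "g ` P \<subseteq> Q"
    using proper_map_imp_subset_topspace[OF proper] by auto
  have Q: "simply_connected Q" "locally path_connected Q"
    using assms(2,3) convex_imp_simply_connected open_imp_locally_path_connected by auto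
  obtain s where s: "continuous_on Q s" "s \<in> Q \<rightarrow> P" "s (g a) = a" "\<And>y. y \<in> Q \<Longrightarrow> g (s y) = y"
  proof (rule covering_space_lift_strong[OF cov _ _ Q continuous_on_id, of a "g a"])
    show "a \<in> P" "g a \<in> Q" using ab B gPQ by auto
  qed auto
  have gB: "g x \<in> Q" if "x \<in> B" for x using that B gPQ by blast
  have sB: "s (g x) \<in> P" if "x \<in> B" for x using gB[OF that] s(2) by blast
  have "(s \<circ> g) b = id b"
  proof (rule covering_space_lift_unique[OF cov, of "s \<circ> g" a id B g b])
    show "continuous_on B g" using cont B(2) by (rule continuous_on_subset)
    then show "continuous_on B (s \<circ> g)"
      by (rule continuous_on_compose) (use s(1) gB in \<open>auto intro: continuous_on_subset\<close>)
    show "g \<in> B \<rightarrow> Q" "s \<circ> g \<in> B \<rightarrow> P" "id \<in> B \<rightarrow> P" using gB sB B(2) by auto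
    show "g x = g ((s \<circ> g) x)" if "x \<in> B" for x using s(4)[OF gB[OF that]] by simp
  qed (simp_all add: ab(1,2) B(1) s(3))
  then show "a = b" using s(3)[unfolded ab(3)] by simp
qed

section \<open>Charts and the interior of a manifold\<close>

lemma e1_in_Basis: "(e1 :: 'e::euclidean_space) \<in> Basis"
  unfolding e1_def using nonempty_Basis by (simp add: some_in_eq)

lemma half_space_eq: "(half_space :: 'e::euclidean_space set) = {x. e1 \<bullet> x \<ge> 0}"
  unfolding half_space_def by (subst inner_commute) (rule refl)

lemma interior_half_space: "interior (half_space :: 'e::euclidean_space set) = {x. 0 < e1 \<bullet> x}"
proof -
  have "(e1 :: 'e) \<noteq> 0" using e1_in_Basis nonzero_Basis by blast
  then show ?thesis
    unfolding half_space_eq by (rule interior_halfspace_ge)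
qed

text \<open>These two properties are shared by both possible ranges of a chart, so that the topological
arguments can treat Euclidean charts and half-space charts alike.\<close>

lemma chart_range_convex:
  assumes "C = UNIV \<or> C = (half_space :: 'e::euclidean_space set)"
  shows "convex C" "C \<subseteq> closure (interior C)"
proof -
  have "convex (half_space :: 'e set)" unfolding half_space_eq by (rule convex_halfspace_ge)
  then show cv: "convex C" using assms convex_UNIV by blast
  have "(e1 :: 'e) \<bullet> e1 = 1" using e1_in_Basis by (rule inner_same_Basis)
  then have "(e1 :: 'e) \<in> interior half_space" unfolding interior_half_space by simp
  then have "(e1 :: 'e) \<in> interior C" using assms by (elim disjE) simp_all
  then have int: "interior C \<noteq> {}" by blast
  show "C \<subseteq> closure (interior C)" unfolding convex_closure_interior[OF cv int] by (rule closure_subset)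
qed

lemma is_chartD:
  fixes \<phi> :: "'a \<Rightarrow> 'e::euclidean_space"
  assumes "is_chart X (U, \<phi>)"
  shows "openin X U" "U \<subseteq> topspace X" "\<phi> ` U = UNIV \<or> \<phi> ` U = half_space"
    and "homeomorphic_map (subtopology X U) (top_of_set (\<phi> ` U)) \<phi>"
    and "inj_on \<phi> U"
proof -
  have h: "openin X U" "homeomorphic_map (subtopology X U) (top_of_set UNIV) \<phi> \<or>
      homeomorphic_map (subtopology X U) (top_of_set half_space) \<phi>"
    using assms unfolding is_chart_def by simp_all
  show "openin X U" by (fact h(1))
  then show U: "U \<subseteq> topspace X" by (rule openin_subset)
  then have top: "topspace (subtopology X U) = U"
    unfolding topspace_subtopology by (rule Int_absorb1)
  have *: "\<phi> ` U = C \<and> homeomorphic_map (subtopology X U) (top_of_set (\<phi> ` U)) \<phi>"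
    if "homeomorphic_map (subtopology X U) (top_of_set C) \<phi>" for C
  proof -
    have "\<phi> ` U = C"
      using homeomorphic_imp_surjective_map[OF that] unfolding top topspace_euclidean_subtopology .
    then show ?thesis using that by simp
  qed
  from h(2) show "\<phi> ` U = UNIV \<or> \<phi> ` U = half_space"
    by (rule disj_forward) (drule *, erule conjunct1)+
  from h(2) show hom: "homeomorphic_map (subtopology X U) (top_of_set (\<phi> ` U)) \<phi>"
    by (rule disjE) (drule *, erule conjunct2)+
  show "inj_on \<phi> U"
    using homeomorphic_imp_injective_map[OF hom] unfolding top .
qed

lemma homeomorphic_map_inv_into:
  assumes "homeomorphic_map X Y f"
  shows "homeomorphic_map Y X (inv_into (topspace X) f)"
proof -
  obtain g where g: "homeomorphic_maps X Y f g"
    by (rule exE[OF assms[unfolded homeomorphic_map_maps]])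
  note inj = homeomorphic_imp_injective_map[OF assms]
  have eq: "g y = inv_into (topspace X) f y" if "y \<in> topspace Y" for y
  proof -
    from that have "y \<in> f ` topspace X" using homeomorphic_imp_surjective_map[OF assms] by simp
    then obtain p where p: "y = f p" "p \<in> topspace X" by (rule imageE)
    have "g (f p) = p" using g p(2) unfolding homeomorphic_maps_def by blast
    then show ?thesis unfolding p(1) inv_into_f_f[OF inj p(2)] .
  qed
  have "homeomorphic_maps X Y f (inv_into (topspace X) f)"
    by (rule homeomorphic_maps_eq[OF g refl eq])
  then show ?thesis
    unfolding homeomorphic_maps_map by blast
qed

lemma chart_inverse:
  fixes \<phi> :: "'a \<Rightarrow> 'e::euclidean_space"
  assumes "is_chart X (U, \<phi>)"
  shows "homeomorphic_map (top_of_set (\<phi> ` U)) (subtopology X U) (inv_into U \<phi>)"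
    and "continuous_map (top_of_set (\<phi> ` U)) X (inv_into U \<phi>)"
proof -
  note c = is_chartD[OF assms]
  have top: "topspace (subtopology X U) = U"
    unfolding topspace_subtopology using c(2) by (rule Int_absorb1)
  show 1: "homeomorphic_map (top_of_set (\<phi> ` U)) (subtopology X U) (inv_into U \<phi>)"
    using homeomorphic_map_inv_into[OF c(4)] unfolding top .
  show "continuous_map (top_of_set (\<phi> ` U)) X (inv_into U \<phi>)"
    by (rule continuous_map_into_fulltopology[OF homeomorphic_imp_continuous_map[OF 1]])
qed

lemma chart_restrict:
  fixes \<phi> :: "'a \<Rightarrow> 'e::euclidean_space"
  assumes "is_chart X (U, \<phi>)" "M \<subseteq> U"
  shows "homeomorphic_map (subtopology X M) (top_of_set (\<phi> ` M)) \<phi>"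
    and "homeomorphic_map (top_of_set (\<phi> ` M)) (subtopology X M) (inv_into U \<phi>)"
    and "inv_into U \<phi> ` \<phi> ` M = M"
proof -
  note c = is_chartD[OF assms(1)]
  have MX: "topspace X \<inter> M = M" using c(2) assms(2) by blast
  have UM: "U \<inter> M = M" "\<phi> ` U \<inter> \<phi> ` M = \<phi> ` M" using assms(2) by blast+
  have top: "topspace (subtopology X U) \<inter> M = M" using MX UM(1) by auto
  show im: "inv_into U \<phi> ` \<phi> ` M = M"
    using c(5) assms(2) by (rule inv_into_image_cancel)
  have "homeomorphic_map (subtopology (subtopology X U) M) (subtopology (top_of_set (\<phi> ` U)) (\<phi> ` M)) \<phi>"
    by (rule homeomorphic_map_subtopologies[OF c(4)]) (simp only: top UM(2) topspace_euclidean_subtopology)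
  then show "homeomorphic_map (subtopology X M) (top_of_set (\<phi> ` M)) \<phi>"
    by (simp add: subtopology_subtopology UM)
  have "homeomorphic_map (subtopology (top_of_set (\<phi> ` U)) (\<phi> ` M)) (subtopology (subtopology X U) M) (inv_into U \<phi>)"
    by (rule homeomorphic_map_subtopologies[OF chart_inverse(1)[OF assms(1)]]) (simp only: top UM(2) im topspace_euclidean_subtopology)
  then show "homeomorphic_map (top_of_set (\<phi> ` M)) (subtopology X M) (inv_into U \<phi>)"
    by (simp add: subtopology_subtopology UM)
qed

lemma continuous_map_in_charts:
  fixes \<phi> :: "'a \<Rightarrow> 'e::euclidean_space" and \<psi> :: "'b \<Rightarrow> 'f::euclidean_space"
  assumes "is_chart X (U, \<phi>)" "is_chart Y (V, \<psi>)" "continuous_map X Y f" "M \<subseteq> U" "f ` M \<subseteq> V"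
  shows "continuous_on (\<phi> ` M) (\<psi> \<circ> f \<circ> inv_into U \<phi>)"
    and "(\<psi> \<circ> f \<circ> inv_into U \<phi>) ` \<phi> ` M = \<psi> ` f ` M"
proof -
  note r = chart_restrict[OF assms(1,4)]
  show "(\<psi> \<circ> f \<circ> inv_into U \<phi>) ` \<phi> ` M = \<psi> ` f ` M"
    unfolding image_comp[symmetric] r(3) ..
  have "continuous_map (subtopology X M) Y f"
    using assms(3) by (rule continuous_map_from_subtopology)
  then have "continuous_map (subtopology X M) (subtopology Y V) f"
    using assms(5) by (auto simp: continuous_map_in_subtopology)
  from continuous_map_compose[OF homeomorphic_imp_continuous_map[OF r(2)] this]
  have "continuous_map (top_of_set (\<phi> ` M)) (subtopology Y V) (f \<circ> inv_into U \<phi>)" .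
  from continuous_map_compose[OF this homeomorphic_imp_continuous_map[OF is_chartD(4)[OF assms(2)]]]
  have "continuous_map (top_of_set (\<phi> ` M)) (top_of_set (\<psi> ` V)) (\<psi> \<circ> (f \<circ> inv_into U \<phi>))" .
  from continuous_map_into_fulltopology[OF this]
  show "continuous_on (\<phi> ` M) (\<psi> \<circ> f \<circ> inv_into U \<phi>)"
    unfolding comp_assoc by (simp only: continuous_map_iff_continuous)
qed

lemma chart_open_image_iff:
  assumes "is_chart X (U, \<phi>)" "N \<subseteq> U"
  shows "openin (top_of_set (\<phi> ` U)) (\<phi> ` N) \<longleftrightarrow> openin X N"
proof -
  note c = is_chartD[OF assms(1)]
  have "openin (top_of_set (\<phi> ` U)) (\<phi> ` N) \<longleftrightarrow> openin (subtopology X U) N"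
    using homeomorphic_map_openness[OF c(4), of N] assms(2) c(2) by auto
  then show ?thesis using openin_open_subtopology[OF c(1)] assms(2) by simp
qed

lemma chart_preimage:
  assumes "is_chart X (U, \<phi>)" "openin (top_of_set (\<phi> ` U)) A"
  shows "openin X {p\<in>U. \<phi> p \<in> A}"
proof -
  have "A \<subseteq> \<phi> ` U" using openin_imp_subset[OF assms(2)] .
  then have "\<phi> ` {p\<in>U. \<phi> p \<in> A} = A" by auto
  then show ?thesis
    using chart_open_image_iff[OF assms(1), of "{p\<in>U. \<phi> p \<in> A}"] assms(2) by auto
qed

lemma manifold_chart:
  assumes "topological_manifold TYPE('e::euclidean_space) X" "p \<in> topspace X"
  obtains U and \<phi> :: "'a \<Rightarrow> 'e::euclidean_space" where "is_chart X (U, \<phi>)" "p \<in> U"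
proof -
  note chart = that
  obtain U where "openin X U" "p \<in> U" "subtopology X U homeomorphic_space (euclidean :: 'e topology) \<or>
           subtopology X U homeomorphic_space top_of_set (half_space :: 'e set)"
    using assms(1) assms(2) unfolding topological_manifold_def by auto
  moreover have "thesis" if "homeomorphic_map (subtopology X U) (euclidean :: 'e topology) \<phi> \<or>
      homeomorphic_map (subtopology X U) (top_of_set half_space) \<phi>" for \<phi> :: "'a \<Rightarrow> 'e"
    using that \<open>openin X U\<close> \<open>p \<in> U\<close> by (intro chart[of U \<phi>]) (auto simp: is_chart_def)
  ultimately show thesis
    unfolding homeomorphic_space by blast
qed

lemma manifold_interior_altdef:
  "manifold_interior TYPE('e::euclidean_space) X =
    {p. \<exists>U. openin X U \<and> p \<in> U \<and> subtopology X U homeomorphic_space (euclidean :: 'e topology)}"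
proof -
  have "p \<in> topspace X" if "openin X U" "p \<in> U" for p U using openin_subset[OF that(1)] that(2) by blast
  then show ?thesis unfolding manifold_interior_def manifold_boundary_def by blast
qed

lemma openin_manifold_interior: "openin X (manifold_interior TYPE('e::euclidean_space) X)"
proof (rule openin_subopen[THEN iffD2], rule ballI)
  fix p assume "p \<in> manifold_interior TYPE('e) X"
  then obtain U where "openin X U" "p \<in> U" "subtopology X U homeomorphic_space (euclidean :: 'e topology)"
    unfolding manifold_interior_altdef by blast
  then show "\<exists>T. openin X T \<and> p \<in> T \<and> T \<subseteq> manifold_interior TYPE('e) X"
    unfolding manifold_interior_altdef by blast
qed

lemma manifold_interior_subset: "manifold_interior TYPE('e::euclidean_space) X \<subseteq> topspace X"
  by (simp add: manifold_interior_def)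

lemma homeomorphic_imp_homeomorphic_space:
  assumes "S homeomorphic T"
  shows "top_of_set S homeomorphic_space top_of_set T"
proof -
  obtain f g where "homeomorphism S T f g" using assms unfolding homeomorphic_def by blast
  then have "homeomorphic_maps (top_of_set S) (top_of_set T) f g"
    unfolding homeomorphic_maps_def homeomorphism_def
    by (auto simp: continuous_map_in_subtopology)
  then show ?thesis unfolding homeomorphic_space_def by blast
qed

text \<open>A ball inside the image of \<open>N\<close> is homeomorphic to the whole space.\<close>

lemma open_chart_image_imp_interior:
  fixes \<phi> :: "'a \<Rightarrow> 'e::euclidean_space"
  assumes "is_chart X (U, \<phi>)" "N \<subseteq> U" "open (\<phi> ` N)"
  shows "N \<subseteq> manifold_interior TYPE('e) X" "openin X N"
proof -
  note c = is_chartD[OF assms(1)]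
  show "openin X N"
    using chart_open_image_iff[OF assms(1,2)] assms(2,3) by (auto intro: open_subset)
  show "N \<subseteq> manifold_interior TYPE('e) X"
  proof
    fix p assume p: "p \<in> N"
    obtain d where d: "d > 0" "ball (\<phi> p) d \<subseteq> \<phi> ` N"
      using assms(3) p by (meson imageI openE)
    define B where "B = {q\<in>U. \<phi> q \<in> ball (\<phi> p) d}"
    have bU: "ball (\<phi> p) d \<subseteq> \<phi> ` U" using d(2) image_mono[OF assms(2)] by (rule order_trans)
    then have im: "\<phi> ` B = ball (\<phi> p) d" unfolding B_def by blast
    have oB: "openin X B"
      unfolding B_def by (rule chart_preimage[OF assms(1)]) (rule open_subset[OF bU open_ball])
    have "B \<subseteq> U" by (auto simp: B_def)
    from chart_restrict(1)[OF assms(1) this]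
    have "homeomorphic_map (subtopology X B) (top_of_set (ball (\<phi> p) d)) \<phi>"
      unfolding im .
    then have "subtopology X B homeomorphic_space top_of_set (ball (\<phi> p) d)"
      by (rule homeomorphic_map_imp_homeomorphic_space)
    also have "top_of_set (ball (\<phi> p) d) homeomorphic_space top_of_set (UNIV :: 'e set)"
      by (rule homeomorphic_imp_homeomorphic_space[OF homeomorphic_ball_UNIV[OF d(1)]])
    finally have "subtopology X B homeomorphic_space (euclidean :: 'e topology)" by simp
    moreover have "p \<in> B" using p assms(2) d(1) by (auto simp: B_def)
    ultimately show "p \<in> manifold_interior TYPE('e) X"
      unfolding manifold_interior_altdef using oB by blast
  qed
qed

text \<open>This is where invariance of domain enters: near an interior point the change from a Euclidean
chart to \<open>\<phi>\<close> is an injective continuous map between sets in spaces of the same dimension, so its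
image is open in the whole space and not just in the half-space.\<close>

lemma interior_imp_open_chart_image:
  fixes \<phi> :: "'a \<Rightarrow> 'e::euclidean_space"
  assumes "is_chart X (U, \<phi>)" "N \<subseteq> U" "openin X N" "N \<subseteq> manifold_interior TYPE('e) X"
  shows "open (\<phi> ` N)"
  unfolding open_subopen[of "\<phi> ` N"]
proof
  fix y assume "y \<in> \<phi> ` N"
  then obtain p where p: "p \<in> N" "y = \<phi> p" by blast
  note c = is_chartD[OF assms(1)]
  obtain V where V: "openin X V" "p \<in> V" "subtopology X V homeomorphic_space (euclidean :: 'e topology)"
    using p(1) assms(4) unfolding manifold_interior_altdef by blast
  then obtain \<psi> where "homeomorphic_map (subtopology X V) (euclidean :: 'e topology) \<psi>"
    unfolding homeomorphic_space by blast
  then have ch: "is_chart X (V, \<psi>)" using V(1) by (simp add: is_chart_def)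
  note c' = is_chartD[OF ch]
  have surj: "\<psi> ` V = UNIV"
    using homeomorphic_imp_surjective_map[OF \<open>homeomorphic_map (subtopology X V) euclidean \<psi>\<close>] c'(2) by auto
  define M where "M = V \<inter> N"
  have M: "M \<subseteq> V" "M \<subseteq> U" "openin X M" "p \<in> M"
    using assms V p by (auto simp: M_def)
  have "open (\<psi> ` M)"
    using chart_open_image_iff[OF ch M(1)] M(3) surj by (simp add: subtopology_UNIV)
  moreover have "continuous_on (\<psi> ` M) (\<phi> \<circ> inv_into V \<psi>)"
    using continuous_map_in_charts(1)[OF ch assms(1) continuous_map_id M(1)] M(2) by simp
  moreover have "inj_on (\<phi> \<circ> inv_into V \<psi>) (\<psi> ` M)"
    using c(5) c'(5) M(1,2) by (intro comp_inj_on inj_on_inv_into)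
      (auto simp: inv_into_image_cancel intro: inj_on_subset)
  ultimately have "open ((\<phi> \<circ> inv_into V \<psi>) ` (\<psi> ` M))"
    by (intro invariance_of_domain)
  moreover have "(\<phi> \<circ> inv_into V \<psi>) ` (\<psi> ` M) = \<phi> ` M"
    using c'(5) M(1) by (metis image_comp inv_into_image_cancel)
  ultimately have "open (\<phi> ` M)" by simp
  then show "\<exists>T. open T \<and> y \<in> T \<and> T \<subseteq> \<phi> ` N"
    using M(4) p(2) by (intro exI[of _ "\<phi> ` M"]) (auto simp: M_def)
qed

text \<open>Interior points, which are defined without charts, can be recognised in any chart. So in a
half-space chart the boundary of the manifold is the part mapped to the boundary hyperplane.\<close>

lemma chart_interior_iff:
  fixes \<phi> :: "'a \<Rightarrow> 'e::euclidean_space"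
  assumes "is_chart X (U, \<phi>)" "p \<in> U"
  shows "p \<in> manifold_interior TYPE('e) X \<longleftrightarrow> \<phi> p \<in> interior (\<phi> ` U)"
proof
  assume "p \<in> manifold_interior TYPE('e) X"
  moreover have "open (\<phi> ` (U \<inter> manifold_interior TYPE('e) X))"
    using is_chartD(1)[OF assms(1)] openin_manifold_interior
    by (intro interior_imp_open_chart_image[OF assms(1)]) auto
  ultimately show "\<phi> p \<in> interior (\<phi> ` U)"
    using assms(2) by (intro interiorI[of "\<phi> ` (U \<inter> manifold_interior TYPE('e) X)"]) auto
next
  assume p: "\<phi> p \<in> interior (\<phi> ` U)"
  have "\<phi> ` {q\<in>U. \<phi> q \<in> interior (\<phi> ` U)} = interior (\<phi> ` U)"
    using interior_subset by blast
  then have "{q\<in>U. \<phi> q \<in> interior (\<phi> ` U)} \<subseteq> manifold_interior TYPE('e) X"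
    by (intro open_chart_image_imp_interior[OF assms(1)]) auto
  then show "p \<in> manifold_interior TYPE('e) X" using p assms(2) by blast
qed

lemma chart_image_interior:
  fixes \<phi> :: "'a \<Rightarrow> 'e::euclidean_space"
  assumes "is_chart X (U, \<phi>)"
  shows "\<phi> ` (U \<inter> manifold_interior TYPE('e) X) = interior (\<phi> ` U)"
proof (intro equalityI subsetI)
  fix y assume "y \<in> \<phi> ` (U \<inter> manifold_interior TYPE('e) X)"
  then show "y \<in> interior (\<phi> ` U)" using chart_interior_iff[OF assms] by auto
next
  fix y assume y: "y \<in> interior (\<phi> ` U)"
  then obtain p where "p \<in> U" "y = \<phi> p" using interior_subset[of "\<phi> ` U"] by auto
  then show "y \<in> \<phi> ` (U \<inter> manifold_interior TYPE('e) X)"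
    using y chart_interior_iff[OF assms] by auto
qed

lemma connectedin_chart_interior:
  fixes \<phi> :: "'a \<Rightarrow> 'e::euclidean_space"
  assumes "is_chart X (U, \<phi>)"
  shows "connectedin X (U \<inter> manifold_interior TYPE('e) X)"
proof -
  note c = is_chartD[OF assms]
  have "connectedin (top_of_set (\<phi> ` U)) (interior (\<phi> ` U))"
    using chart_range_convex(1)[OF c(3)] interior_subset[of "\<phi> ` U"]
    by (auto simp: connectedin_subtopology intro!: convex_connected convex_interior)
  from connectedin_continuous_map_image[OF chart_inverse(2)[OF assms] this]
  show ?thesis
    using c(5) unfolding chart_image_interior[OF assms, symmetric] by (simp add: inv_into_image_cancel)
qed

lemma manifold_interior_dense:
  assumes "topological_manifold TYPE('e::euclidean_space) X" "openin X N" "N \<noteq> {}"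
  shows "N \<inter> manifold_interior TYPE('e) X \<noteq> {}"
proof -
  obtain p where p: "p \<in> N" using assms(3) by blast
  then have "p \<in> topspace X" using assms(2) openin_subset by blast
  then obtain U and \<phi> :: "'a \<Rightarrow> 'e" where ch: "is_chart X (U, \<phi>)" "p \<in> U"
    using manifold_chart[OF assms(1)] by blast
  note c = is_chartD[OF ch(1)]
  have "openin (top_of_set (\<phi> ` U)) (\<phi> ` (U \<inter> N))"
    using chart_open_image_iff[OF ch(1), of "U \<inter> N"] c(1) assms(2) by auto
  then obtain A where A: "open A" "\<phi> ` (U \<inter> N) = \<phi> ` U \<inter> A" by (auto simp: openin_open)
  have "\<phi> p \<in> A" using A(2) p ch(2) by blast
  moreover have "\<phi> p \<in> closure (interior (\<phi> ` U))"
    using chart_range_convex(2)[OF c(3)] ch(2) by blast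
  ultimately have "A \<inter> interior (\<phi> ` U) \<noteq> {}"
    using A(1) by (meson IntI closure_iff_nhds_not_empty disjoint_iff order_refl)
  then obtain y where y: "y \<in> A" "y \<in> interior (\<phi> ` U)" by blast
  then have "y \<in> \<phi> ` (U \<inter> N)" using A(2) interior_subset by blast
  then obtain q where "q \<in> U" "q \<in> N" "y = \<phi> q" by blast
  then show ?thesis using chart_interior_iff[OF ch(1), of q] y(2) by blast
qed

text \<open>This says that the interior of a connected manifold is connected. Each of two complementary open
parts of the interior is thickened by the open sets that meet the interior only in that
part. The thickenings are disjoint because the interior is dense, and they cover \<open>X\<close> because the
interior part of a chart domain is connected and thus lies in one of the two parts.\<close>

lemma manifold_interior_clopen:
  assumes mf: "topological_manifold TYPE('e::euclidean_space) X" and "connected_space X"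
    and "openin X T" "openin X (manifold_interior TYPE('e) X - T)" "T \<subseteq> manifold_interior TYPE('e) X"
  shows "T = {} \<or> T = manifold_interior TYPE('e) X"
proof -
  let ?I = "manifold_interior TYPE('e) X"
  \<comment> \<open>the points with a neighbourhood whose interior points all lie in \<open>T\<close>\<close>
  define E where "E T = \<Union>{N. openin X N \<and> N \<inter> ?I \<subseteq> T}" for T
  have oE: "openin X (E T)" for T by (auto simp: E_def)
  have EI: "p \<in> E T" if "openin X N" "p \<in> N" "N \<inter> ?I \<subseteq> T" for p N T
    using that by (auto simp: E_def)
  have "E T \<inter> E (?I - T) = {}"
  proof (rule ccontr)
    assume "E T \<inter> E (?I - T) \<noteq> {}"
    then have "E T \<inter> E (?I - T) \<inter> ?I \<noteq> {}"
      by (intro manifold_interior_dense[OF mf]) (use oE in auto)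
    then show False by (auto simp: E_def)
  qed
  moreover have "topspace X \<subseteq> E T \<union> E (?I - T)"
  proof
    fix p assume "p \<in> topspace X"
    then obtain U and \<phi> :: "'a \<Rightarrow> 'e" where ch: "is_chart X (U, \<phi>)" "p \<in> U"
      using manifold_chart[OF mf] by blast
    have "connectedin X (U \<inter> ?I)" using ch(1) by (rule connectedin_chart_interior)
    then have "U \<inter> ?I \<subseteq> T \<or> U \<inter> ?I \<subseteq> ?I - T"
      using assms(3,4) unfolding connectedin by blast
    then show "p \<in> E T \<union> E (?I - T)"
      using EI[OF is_chartD(1)[OF ch(1)] ch(2)] by blast
  qed
  ultimately have "E T = {} \<or> E (?I - T) = {}"
    using assms(2) oE unfolding connected_space_def by blast
  moreover have "T \<subseteq> E T" "?I - T \<subseteq> E (?I - T)"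
    using assms(3,4) by (auto simp: E_def)
  ultimately show ?thesis using assms(5) by blast
qed

section \<open>Locally injective maps between manifolds with boundary\<close>

text \<open>In charts this is invariance of domain. The image avoids the boundary of \<open>Y\<close> since a set that is
open in the whole Euclidean space and contained in the half-space lies in the open half-space.\<close>

lemma locally_inj_interior_open:
  fixes f :: "'a \<Rightarrow> 'b"
  assumes X: "topological_manifold TYPE('e::euclidean_space) X"
    and Y: "topological_manifold TYPE('e) Y"
    and cont: "continuous_map X Y f"
    and loc: "\<And>p. p \<in> manifold_interior TYPE('e) X \<Longrightarrow> \<exists>N. openin X N \<and> p \<in> N \<and> inj_on f N"
    and N: "openin X N" "N \<subseteq> manifold_interior TYPE('e) X"
  shows "openin Y (f ` N)" "f ` N \<subseteq> manifold_interior TYPE('e) Y"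
proof -
  have key: "\<exists>M. p \<in> M \<and> M \<subseteq> N \<and> openin Y (f ` M) \<and> f ` M \<subseteq> manifold_interior TYPE('e) Y"
    if p: "p \<in> N" for p
  proof -
    have pX: "p \<in> topspace X" using p N(1) openin_subset by blast
    then have "f p \<in> topspace Y" using cont continuous_map_image_subset_topspace by blast
    then obtain V and \<psi> :: "'b \<Rightarrow> 'e" where d: "is_chart Y (V, \<psi>)" "f p \<in> V"
      using manifold_chart[OF Y] by blast
    obtain U and \<phi> :: "'a \<Rightarrow> 'e" where c: "is_chart X (U, \<phi>)" "p \<in> U"
      using manifold_chart[OF X pX] by blast
    obtain N0 where N0: "openin X N0" "p \<in> N0" "inj_on f N0"
      using loc[of p] p N(2) by blast
    define M where "M = {q \<in> N \<inter> N0 \<inter> U. f q \<in> V}"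
    have oM: "openin X M"
      unfolding M_def
      by (intro openin_continuous_map_preimage_gen[OF cont] openin_Int N(1) N0(1) is_chartD(1)[OF c(1)] is_chartD(1)[OF d(1)])
    have M: "p \<in> M" "M \<subseteq> N" "M \<subseteq> U" "f ` M \<subseteq> V" "M \<subseteq> N0"
      using p N0(2) c(2) d(2) by (auto simp: M_def)
    have "open (\<phi> ` M)"
      by (rule interior_imp_open_chart_image[OF c(1) M(3) oM]) (use M(2) N(2) in blast)
    moreover have "inj_on (\<psi> \<circ> f \<circ> inv_into U \<phi>) (\<phi> ` M)"
    proof (rule comp_inj_on)
      show "inj_on (inv_into U \<phi>) (\<phi> ` M)" using M(3) by (intro inj_on_inv_into image_mono)
      have "inj_on f M" using N0(3) M(5) by (rule inj_on_subset)
      moreover have "inj_on \<psi> (f ` M)" using is_chartD(5)[OF d(1)] M(4) by (rule inj_on_subset)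
      ultimately show "inj_on (\<psi> \<circ> f) (inv_into U \<phi> ` \<phi> ` M)"
        unfolding chart_restrict(3)[OF c(1) M(3)] by (rule comp_inj_on)
    qed
    ultimately have "open ((\<psi> \<circ> f \<circ> inv_into U \<phi>) ` (\<phi> ` M))"
      using continuous_map_in_charts(1)[OF c(1) d(1) cont M(3,4)] by (intro invariance_of_domain)
    then have "open (\<psi> ` (f ` M))"
      unfolding continuous_map_in_charts(2)[OF c(1) d(1) cont M(3,4)] .
    from open_chart_image_imp_interior[OF d(1) M(4) this] M(1,2) show ?thesis
      by (intro exI[of _ M] conjI)
  qed
  show "f ` N \<subseteq> manifold_interior TYPE('e) Y"
  proof (rule image_subsetI)
    fix p assume "p \<in> N"
    from key[OF this] obtain M where "p \<in> M" "f ` M \<subseteq> manifold_interior TYPE('e) Y" by (elim exE conjE)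
    then show "f p \<in> manifold_interior TYPE('e) Y" by auto
  qed
  show "openin Y (f ` N)"
  proof (rule openin_subopen[THEN iffD2], rule ballI)
    fix y assume "y \<in> f ` N"
    then obtain p where p: "p \<in> N" "y = f p" by blast
    from key[OF p(1)] obtain M where "p \<in> M" "M \<subseteq> N" "openin Y (f ` M)" by (elim exE conjE)
    then show "\<exists>T. openin Y T \<and> y \<in> T \<and> T \<subseteq> f ` N"
      using p(2) by (intro exI[of _ "f ` M"]) auto
  qed
qed

text \<open>Two distinct points with the same image have disjoint neighbourhoods, whose images overlap in an
open set of double points. Conversely, if \<open>y\<close> has the single preimage \<open>p\<close>, then, \<open>f\<close> being closed,
all preimages of points near \<open>y\<close> lie in a neighbourhood of \<open>p\<close> on which \<open>f\<close> is injective.\<close>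

lemma double_points_clopen:
  assumes "Hausdorff_space X" "closed_map X Y f"
    and I: "openin X I" "openin Y (f ` I)" "\<And>p. p \<in> topspace X \<Longrightarrow> f p \<in> f ` I \<Longrightarrow> p \<in> I"
    and opn: "\<And>N. openin X N \<Longrightarrow> N \<subseteq> I \<Longrightarrow> openin Y (f ` N)"
    and loc: "\<And>p. p \<in> I \<Longrightarrow> \<exists>N. openin X N \<and> p \<in> N \<and> inj_on f N"
  defines "D \<equiv> {y. \<exists>p\<in>I. \<exists>q\<in>I. p \<noteq> q \<and> f p = y \<and> f q = y}"
  shows "openin Y D" "openin Y (f ` I - D)"
proof -
  have IX: "I \<subseteq> topspace X" using I(1) by (rule openin_subset)
  show "openin Y D"
  proof (rule openin_subopen[THEN iffD2], rule ballI)
    fix y assume "y \<in> D"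
    then obtain p q where pq: "p \<in> I" "q \<in> I" "p \<noteq> q" "f p = y" "f q = y"
      unfolding D_def by (elim CollectE bexE conjE)
    have "p \<in> topspace X" "q \<in> topspace X" using IX pq(1,2) by auto
    then obtain A B where AB: "openin X A" "openin X B" "p \<in> A" "q \<in> B" "disjnt A B"
      using assms(1)[unfolded Hausdorff_space_def, rule_format, of p q] pq(3) by auto
    have "openin Y (f ` (A \<inter> I) \<inter> f ` (B \<inter> I))"
      by (intro openin_Int opn AB I(1)) auto
    moreover have "f ` (A \<inter> I) \<inter> f ` (B \<inter> I) \<subseteq> D"
    proof (rule subsetI)
      fix z assume "z \<in> f ` (A \<inter> I) \<inter> f ` (B \<inter> I)"
      then obtain a b where "a \<in> A" "a \<in> I" "b \<in> B" "b \<in> I" "f a = z" "f b = z" by auto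
      moreover have "a \<noteq> b" using AB(5) \<open>a \<in> A\<close> \<open>b \<in> B\<close> by (auto simp: disjnt_iff)
      ultimately show "z \<in> D" unfolding D_def by (intro CollectI bexI[of _ a] bexI[of _ b] conjI)
    qed
    moreover have "y \<in> f ` (A \<inter> I) \<inter> f ` (B \<inter> I)"
      using pq AB(3,4) by (intro IntI rev_image_eqI[of p] rev_image_eqI[of q]) auto
    ultimately show "\<exists>T. openin Y T \<and> y \<in> T \<and> T \<subseteq> D"
      by (intro exI[of _ "f ` (A \<inter> I) \<inter> f ` (B \<inter> I)"] conjI)
  qed
  show "openin Y (f ` I - D)"
  proof (rule openin_subopen[THEN iffD2], rule ballI)
    fix y assume y: "y \<in> f ` I - D"
    then obtain p where p: "p \<in> I" "f p = y" by auto
    obtain N where N: "openin X N" "p \<in> N" "inj_on f N" using loc[OF p(1)] by blast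
    have "{x \<in> topspace X. f x = y} \<subseteq> N"
    proof
      fix x assume "x \<in> {x \<in> topspace X. f x = y}"
      then have x: "x \<in> topspace X" "f x = y" by auto
      have "f x \<in> f ` I" using y x(2) by simp
      with x(1) have "x \<in> I" by (rule I(3))
      then have "x = p" using y p x(2) unfolding D_def by auto
      then show "x \<in> N" using N(2) by simp
    qed
    moreover have "y \<in> topspace Y" using y openin_subset[OF I(2)] by auto
    ultimately obtain V where V: "openin Y V" "y \<in> V" "{x \<in> topspace X. f x \<in> V} \<subseteq> N"
      using assms(2)[unfolded closed_map_fibre_neighbourhood, THEN conjunct2, rule_format, of N y] N(1) by auto
    have "V \<inter> f ` I \<subseteq> f ` I - D"
    proof
      fix z assume z: "z \<in> V \<inter> f ` I"
      have "z \<notin> D"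
      proof
        assume "z \<in> D"
        then obtain a b where ab: "a \<in> I" "b \<in> I" "a \<noteq> b" "f a = z" "f b = z"
          unfolding D_def by (elim CollectE bexE conjE)
        then have "a \<in> N" "b \<in> N" using V(3) z IX by auto
        then show False using N(3) ab by (auto dest: inj_onD)
      qed
      then show "z \<in> f ` I - D" using z by blast
    qed
    then show "\<exists>T. openin Y T \<and> y \<in> T \<and> T \<subseteq> f ` I - D"
      using V(1,2) I(2) y by (intro exI[of _ "V \<inter> f ` I"]) auto
  qed
qed

text \<open>Close to the image of a boundary point \<open>x0\<close> a point \<open>y\<close> is found that is not doubly covered.
Since \<open>x0\<close> is the only preimage of \<open>f x0\<close>, preimages of small neighbourhoods of \<open>f x0\<close> are small,
and everything takes place inside one chart around \<open>x0\<close> and one around \<open>f x0\<close>: there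
\<open>f\<close> restricts to a proper local homeomorphism \<open>g\<close> from an open set \<open>P\<close> to an open convex set \<open>Q\<close>,
and \<open>P\<close> contains the interior \<open>B\<close> of a half-ball around \<open>x0\<close>. Such a map is injective on \<open>B\<close>. The behaviour of \<open>f\<close> at
\<open>x0\<close> itself enters only through continuity and the uniqueness of the preimage.\<close>

lemma single_point_near_boundary:
  fixes f :: "'a \<Rightarrow> 'b"
  assumes X: "topological_manifold TYPE('e::euclidean_space) X"
    and Y: "topological_manifold TYPE('e) Y"
    and cX: "compact_space X" and cont: "continuous_map X Y f"
    and loc: "\<And>p. p \<in> manifold_interior TYPE('e) X \<Longrightarrow> \<exists>N. openin X N \<and> p \<in> N \<and> inj_on f N"
    and x0: "x0 \<in> manifold_boundary TYPE('e) X"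
    and fbd: "f ` manifold_boundary TYPE('e) X \<subseteq> manifold_boundary TYPE('e) Y"
    and inj: "inj_on f (manifold_boundary TYPE('e) X)"
  shows "\<exists>y\<in>manifold_interior TYPE('e) Y.
    \<forall>p\<in>manifold_interior TYPE('e) X. \<forall>q\<in>manifold_interior TYPE('e) X. f p = y \<longrightarrow> f q = y \<longrightarrow> p = q"
proof -
  let ?IX = "manifold_interior TYPE('e) X" and ?IY = "manifold_interior TYPE('e) Y"
  have HY: "Hausdorff_space Y" using Y by (simp add: topological_manifold_def)
  have prp: "proper_map X Y f"
    by (rule continuous_imp_proper_map[OF cX Hausdorff_imp_kc_space[OF HY] cont])
  then have clf: "closed_map X Y f" by (rule proper_imp_closed_map)
  have fI: "f ` ?IX \<subseteq> ?IY"
    by (rule locally_inj_interior_open(2)[OF X Y cont loc openin_manifold_interior order_refl])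
  have split: "p \<in> ?IX \<or> p \<in> manifold_boundary TYPE('e) X" if "p \<in> topspace X" for p
    using that by (auto simp: manifold_interior_def)
  have disj: "y \<notin> manifold_boundary TYPE('e) Y" if "y \<in> ?IY" for y
    using that by (auto simp: manifold_interior_def)
  have preI: "p \<in> ?IX" if "p \<in> topspace X" "f p \<in> ?IY" for p
    using split[OF that(1)] disj[OF that(2)] fbd by blast
  have x0X: "x0 \<in> topspace X" using x0 by (simp add: manifold_boundary_def)
  then have y0Y: "f x0 \<in> topspace Y" using cont continuous_map_image_subset_topspace by blast
  have fib: "{x \<in> topspace X. f x = f x0} = {x0}"
  proof -
    have "x = x0" if "x \<in> topspace X" "f x = f x0" for x
    proof -
      have "f x0 \<notin> ?IY" using disj fbd x0 by blast
      then have "x \<notin> ?IX" using fI unfolding that(2)[symmetric] by blast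
      then have "x \<in> manifold_boundary TYPE('e) X" using split[OF that(1)] by blast
      then show ?thesis using inj_onD[OF inj that(2) _ x0] by blast
    qed
    then show ?thesis using x0X by blast
  qed
  \<comment> \<open>the neighbourhoods of \<open>x0\<close> shrink with those of \<open>f x0\<close>, since \<open>f\<close> is closed\<close>
  have shrink: "\<exists>W. openin Y W \<and> f x0 \<in> W \<and> {x \<in> topspace X. f x \<in> W} \<subseteq> A"
    if "openin X A" "x0 \<in> A" for A
  proof -
    have "{x \<in> topspace X. f x = f x0} \<subseteq> A" unfolding fib using that(2) by simp
    then show ?thesis
      using clf[unfolded closed_map_fibre_neighbourhood, THEN conjunct2, rule_format, of A "f x0"] y0Y that(1)
      by auto
  qed
  obtain U and \<phi> :: "'a \<Rightarrow> 'e" where c: "is_chart X (U, \<phi>)" "x0 \<in> U"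
    using manifold_chart[OF X x0X] by blast
  obtain V and \<psi> :: "'b \<Rightarrow> 'e" where d: "is_chart Y (V, \<psi>)" "f x0 \<in> V"
    using manifold_chart[OF Y y0Y] by blast
  note cD = is_chartD[OF c(1)] and dD = is_chartD[OF d(1)]
  have ball_chart: "\<exists>e>0. \<forall>q\<in>U'. \<phi>' q \<in> ball (\<phi>' z) e \<longrightarrow> q \<in> A"
    if ch: "is_chart Z (U', \<phi>')" "z \<in> U'" "openin Z A" "z \<in> A" for Z :: "'z topology" and U' and \<phi>' :: "'z \<Rightarrow> 'e" and z A
  proof -
    note D = is_chartD[OF ch(1)]
    have "openin Z (U' \<inter> A)" using D(1) ch(3) by (rule openin_Int)
    then have "openin (top_of_set (\<phi>' ` U')) (\<phi>' ` (U' \<inter> A))"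
      using chart_open_image_iff[OF ch(1), of "U' \<inter> A"] by blast
    moreover have "\<phi>' z \<in> \<phi>' ` (U' \<inter> A)" using ch(2,4) by (intro imageI IntI)
    ultimately obtain e where e: "e > 0" "ball (\<phi>' z) e \<inter> \<phi>' ` U' \<subseteq> \<phi>' ` (U' \<inter> A)"
      unfolding openin_contains_ball by blast
    have "q \<in> A" if q: "q \<in> U'" "\<phi>' q \<in> ball (\<phi>' z) e" for q
    proof -
      have "\<phi>' q \<in> \<phi>' ` (U' \<inter> A)" using e(2) q by blast
      then obtain q' where "q' \<in> U'" "q' \<in> A" "\<phi>' q = \<phi>' q'" by blast
      then show ?thesis using inj_onD[OF D(5), of q q'] q(1) by blast
    qed
    then show ?thesis using e(1) by blast
  qed
  have ball_open: "openin Z {q\<in>U'. \<phi>' q \<in> ball z e}"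
    if "is_chart Z (U', \<phi>')" for Z :: "'z topology" and U' and \<phi>' :: "'z \<Rightarrow> 'e" and z e
  proof -
    have "openin (top_of_set (\<phi>' ` U')) (\<phi>' ` U' \<inter> ball z e)" by (rule openin_open_Int) simp
    from chart_preimage[OF that this] show ?thesis by (rule back_subst[of "openin Z"]) auto
  qed
  obtain V1 where V1: "openin Y V1" "f x0 \<in> V1" "{x \<in> topspace X. f x \<in> V1} \<subseteq> U"
    using shrink[OF cD(1) c(2)] by blast
  obtain e where e: "e > 0" "\<And>y. y \<in> V \<Longrightarrow> \<psi> y \<in> ball (\<psi> (f x0)) e \<Longrightarrow> y \<in> V1"
    using ball_chart[OF d V1(1,2)] by blast
  \<comment> \<open>the convex half-ball: its preimage under \<open>f\<close> lies in the chart domain \<open>U\<close>\<close>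
  define Q where "Q = ball (\<psi> (f x0)) e \<inter> interior (\<psi> ` V)"
  have Q: "open Q" "convex Q" "Q \<subseteq> \<psi> ` V"
    using chart_range_convex(1)[OF dD(3)] interior_subset[of "\<psi> ` V"]
    by (auto simp: Q_def intro!: convex_Int convex_interior)
  define VQ where "VQ = {y\<in>V. \<psi> y \<in> Q}"
  have VQ: "VQ \<subseteq> V" "\<psi> ` VQ = Q" "VQ \<subseteq> V1" using Q(3) e(2) by (auto simp: VQ_def Q_def)
  have oVQ: "openin Y VQ" "VQ \<subseteq> ?IY"
    using open_chart_image_imp_interior[OF d(1) VQ(1)] VQ(2) Q(1) by simp_all
  define UP where "UP = {x \<in> topspace X. f x \<in> VQ}"
  have UP: "UP \<subseteq> U" "UP \<subseteq> ?IX" "openin X UP" "f ` UP \<subseteq> V"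
    using V1(3) VQ(1,3) oVQ(2) preI openin_continuous_map_preimage[OF cont oVQ(1)]
    by (auto simp: UP_def)
  define P where "P = \<phi> ` UP"
  have oP: "open P"
    unfolding P_def by (rule interior_imp_open_chart_image[OF c(1) UP(1,3,2)])
  define g where "g = \<psi> \<circ> f \<circ> inv_into U \<phi>"
  have g: "g (\<phi> x) = \<psi> (f x)" if "x \<in> U" for x
    using inv_into_f_f[OF cD(5) that] by (simp add: g_def)
  \<comment> \<open>properness of \<open>f\<close> survives because \<open>UP\<close> is the full preimage of \<open>VQ\<close>\<close>
  have "proper_map (top_of_set P) (subtopology X UP) (inv_into U \<phi>)"
    unfolding P_def by (rule homeomorphic_imp_proper_map[OF chart_restrict(2)[OF c(1) UP(1)]])
  moreover have "proper_map (subtopology X UP) (subtopology Y VQ) f"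
    by (rule proper_map_restriction[OF prp]) (simp add: UP_def)
  moreover have "proper_map (subtopology Y VQ) (top_of_set Q) \<psi>"
    using homeomorphic_imp_proper_map[OF chart_restrict(1)[OF d(1) VQ(1)]] VQ(2) by simp
  ultimately have gprop: "proper_map (top_of_set P) (top_of_set Q) g"
    unfolding g_def comp_assoc by (intro proper_map_compose)
  have gcont: "continuous_on P g"
    unfolding P_def g_def by (rule continuous_map_in_charts(1)[OF c(1) d(1) cont UP(1,4)])
  have gloc: "\<exists>N. open N \<and> b \<in> N \<and> inj_on g N" if b: "b \<in> P" for b
  proof -
    obtain x where x: "x \<in> UP" "b = \<phi> x" using b unfolding P_def by blast
    obtain N where N: "openin X N" "x \<in> N" "inj_on f N" using loc[of x] x(1) UP(2) by blast
    have oN: "openin X (N \<inter> UP)" using N(1) UP(3) by (rule openin_Int)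
    have "open (\<phi> ` (N \<inter> UP))"
      using UP by (intro interior_imp_open_chart_image[OF c(1) _ oN]) auto
    moreover have "inj_on g (\<phi> ` (N \<inter> UP))"
    proof (rule inj_onI)
      fix a b assume "a \<in> \<phi> ` (N \<inter> UP)" "b \<in> \<phi> ` (N \<inter> UP)" "g a = g b"
      then obtain u v where uv: "u \<in> N" "u \<in> UP" "a = \<phi> u" "v \<in> N" "v \<in> UP" "b = \<phi> v" "g a = g b" by blast
      have "\<psi> (f u) = \<psi> (f v)"
        using uv(7) unfolding uv(3,6) g[OF subsetD[OF UP(1) uv(2)]] g[OF subsetD[OF UP(1) uv(5)]] .
      then have "f u = f v" by (rule inj_onD[OF dD(5)]) (use uv(2,5) UP(4) in blast)+
      then have "u = v" by (rule inj_onD[OF N(3) _ uv(1,4)])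
      then show "a = b" using uv(3,6) by simp
    qed
    ultimately show ?thesis using x N(2) by blast
  qed
  \<comment> \<open>unlike \<open>UP\<close>, the preimage of the half-ball together with its boundary part is a neighbourhood of \<open>x0\<close>\<close>
  define UV where "UV = {x \<in> U. f x \<in> {y\<in>V. \<psi> y \<in> ball (\<psi> (f x0)) e}}"
  have oUV: "openin X UV"
    unfolding UV_def by (rule openin_continuous_map_preimage_gen[OF cont cD(1) ball_open[OF d(1)]])
  have "x0 \<in> UV" using c(2) d(2) e(1) by (simp add: UV_def)
  then obtain \<delta> where \<delta>: "\<delta> > 0" "\<And>x. x \<in> U \<Longrightarrow> \<phi> x \<in> ball (\<phi> x0) \<delta> \<Longrightarrow> x \<in> UV"
    using ball_chart[OF c oUV] by blast
  define B where "B = ball (\<phi> x0) \<delta> \<inter> interior (\<phi> ` U)"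
  have "connected B"
    using chart_range_convex(1)[OF cD(3)] unfolding B_def
    by (intro convex_connected convex_Int convex_ball convex_interior)
  moreover have "B \<subseteq> P"
  proof
    fix b assume b: "b \<in> B"
    then obtain x where x: "x \<in> U" "b = \<phi> x" using interior_subset[of "\<phi> ` U"] unfolding B_def by blast
    have "x \<in> UV" using \<delta>(2)[OF x(1)] b x(2) by (simp add: B_def)
    then have fx: "f x \<in> V" "\<psi> (f x) \<in> ball (\<psi> (f x0)) e" by (auto simp: UV_def)
    have "x \<in> ?IX" using chart_interior_iff[OF c(1) x(1)] b x(2) by (simp add: B_def)
    then have "f x \<in> ?IY" using fI by blast
    then have "\<psi> (f x) \<in> interior (\<psi> ` V)" using chart_interior_iff[OF d(1) fx(1)] by simp
    then have "f x \<in> VQ" using fx by (simp add: VQ_def Q_def)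
    then have "x \<in> UP" using x(1) cD(2) by (auto simp: UP_def)
    then show "b \<in> P" using x(2) by (simp add: P_def)
  qed
  ultimately have ginj: "inj_on g B"
    using proper_local_homeo_inj_on_connected[OF oP Q(1,2) gprop gcont gloc] by blast
  \<comment> \<open>any interior point \<open>y\<close> whose preimages all lie in the half-ball will do\<close>
  define UB where "UB = {x\<in>U. \<phi> x \<in> ball (\<phi> x0) \<delta>}"
  have UB: "openin X UB" "x0 \<in> UB"
    using ball_open[OF c(1)] c(2) \<delta>(1) by (auto simp: UB_def)
  obtain W where W: "openin Y W" "f x0 \<in> W" "{x \<in> topspace X. f x \<in> W} \<subseteq> UB"
    using shrink[OF UB] by blast
  obtain y where y: "y \<in> W" "y \<in> ?IY"
    using manifold_interior_dense[OF Y W(1)] W(2) by blast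
  show ?thesis
  proof (intro bexI[OF _ y(2)] ballI impI)
    fix p q assume pq: "p \<in> ?IX" "q \<in> ?IX" "f p = y" "f q = y"
    have in_B: "u \<in> U \<and> \<phi> u \<in> B" if "u \<in> ?IX" "f u = y" for u
    proof -
      have "u \<in> topspace X" using that(1) by (rule subsetD[OF manifold_interior_subset])
      then have u: "u \<in> U" "\<phi> u \<in> ball (\<phi> x0) \<delta>" using W(3) that(2) y(1) by (auto simp: UB_def)
      then show ?thesis using chart_interior_iff[OF c(1) u(1)] that(1) by (simp add: B_def)
    qed
    note p = in_B[OF pq(1,3)] and q = in_B[OF pq(2,4)]
    have "g (\<phi> p) = g (\<phi> q)" using g[of p] g[of q] p q pq(3,4) by simp
    then have "\<phi> p = \<phi> q" using inj_onD[OF ginj, of "\<phi> p" "\<phi> q"] p q by blast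
    then show "p = q" using inj_onD[OF cD(5), of p q] p q by blast
  qed
qed

text \<open>The topological core of the theorem. A continuous bijection from a compact space to a Hausdorff
space is a homeomorphism, so only bijectivity is at stake. Surjectivity and injectivity on the
interior both come from sets that are open and closed in the interior of \<open>Y\<close>.\<close>

proposition locally_injective_imp_homeomorphic_map:
  fixes f :: "'a \<Rightarrow> 'b"
  assumes X: "topological_manifold TYPE('e::euclidean_space) X"
    and Y: "topological_manifold TYPE('e) Y"
    and cX: "compact_space X" and "connected_space Y"
    and bd: "manifold_boundary TYPE('e) X \<noteq> {}"
    and cont: "continuous_map X Y f"
    and loc: "\<And>p. p \<in> manifold_interior TYPE('e) X \<Longrightarrow> \<exists>N. openin X N \<and> p \<in> N \<and> inj_on f N"
    and fbd: "f ` manifold_boundary TYPE('e) X \<subseteq> manifold_boundary TYPE('e) Y"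
    and inj: "inj_on f (manifold_boundary TYPE('e) X)"
  shows "homeomorphic_map X Y f" "f ` manifold_interior TYPE('e) X = manifold_interior TYPE('e) Y"
proof -
  let ?IX = "manifold_interior TYPE('e) X" and ?IY = "manifold_interior TYPE('e) Y"
  have HY: "Hausdorff_space Y" and HX: "Hausdorff_space X"
    using X Y by (simp_all add: topological_manifold_def)
  have clf: "closed_map X Y f" using continuous_imp_closed_map[OF cont cX HY] .
  have opn: "openin Y (f ` N)" "f ` N \<subseteq> ?IY" if "openin X N" "N \<subseteq> ?IX" for N
    using locally_inj_interior_open[OF X Y cont loc that] by blast+
  have fI: "f ` ?IX \<subseteq> ?IY" by (rule opn(2)[OF openin_manifold_interior order_refl])
  have oI: "openin Y (f ` ?IX)" by (rule opn(1)[OF openin_manifold_interior order_refl])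
  obtain x0 where x0: "x0 \<in> manifold_boundary TYPE('e) X" using bd by blast
  have preI: "p \<in> ?IX" if "p \<in> topspace X" "f p \<in> ?IY" for p
    using that fbd by (auto simp: manifold_interior_def)
  have clX: "closedin Y (f ` topspace X)"
    using clf by (simp add: closed_map_def)
  \<comment> \<open>interior points are the only ones mapped to \<open>?IY\<close>\<close>
  have eq: "?IY - f ` ?IX = ?IY - f ` topspace X"
    using preI manifold_interior_subset[where 'e='e, of X] by blast
  have "openin Y (?IY - f ` ?IX)"
    unfolding eq using openin_manifold_interior clX by (rule openin_diff)
  then have "f ` ?IX = {} \<or> f ` ?IX = ?IY"
    by (rule manifold_interior_clopen[OF Y assms(4) oI _ fI])
  moreover have "?IX \<noteq> {}"
  proof -
    have "topspace X \<noteq> {}" using x0 unfolding manifold_boundary_def by blast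
    from manifold_interior_dense[OF X openin_topspace this] show ?thesis by blast
  qed
  ultimately show im: "f ` ?IX = ?IY" by blast
  have surj: "f ` topspace X = topspace Y"
  proof (rule ccontr)
    assume ne: "f ` topspace X \<noteq> topspace Y"
    have "openin Y (topspace Y - f ` topspace X)" using clX by (simp add: closedin_def)
    moreover have "topspace Y - f ` topspace X \<noteq> {}"
      using ne closedin_subset[OF clX] by blast
    ultimately have "(topspace Y - f ` topspace X) \<inter> ?IY \<noteq> {}"
      by (rule manifold_interior_dense[OF Y])
    then show False unfolding im[symmetric] using manifold_interior_subset[where 'e='e, of X] by blast
  qed
  define D where "D = {y. \<exists>p\<in>?IX. \<exists>q\<in>?IX. p \<noteq> q \<and> f p = y \<and> f q = y}"
  have "openin Y D" "openin Y (?IY - D)"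
    using double_points_clopen[OF HX clf openin_manifold_interior oI _ opn(1) loc] preI
    unfolding im D_def by simp_all
  moreover have "D \<subseteq> ?IY" using fI by (auto simp: D_def)
  ultimately have "D = {} \<or> D = ?IY" by (intro manifold_interior_clopen[OF Y assms(4)])
  moreover have "\<exists>y\<in>?IY. \<forall>p\<in>?IX. \<forall>q\<in>?IX. f p = y \<longrightarrow> f q = y \<longrightarrow> p = q"
    by (rule single_point_near_boundary[OF X Y cX cont loc x0 fbd inj])
  then obtain y where "y \<in> ?IY" "y \<notin> D" unfolding D_def by blast
  ultimately have "D = {}" by blast
  have "inj_on f (topspace X)"
  proof (rule inj_onI)
    fix p q assume pq: "p \<in> topspace X" "q \<in> topspace X" "f p = f q"
    show "p = q"
    proof (cases "f p \<in> ?IY")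
      case True
      then have "p \<in> ?IX" "q \<in> ?IX" using preI pq by auto
      then show ?thesis using \<open>D = {}\<close> pq(3) by (auto simp: D_def)
    next
      case False
      then have "p \<notin> ?IX" "q \<notin> ?IX" using fI pq(3) by auto
      then show ?thesis using pq inj by (auto simp: manifold_interior_def dest: inj_onD)
    qed
  qed
  then show "homeomorphic_map X Y f"
    using continuous_imp_homeomorphic_map[OF cont cX HY surj] by blast
qed

section \<open>From topology to smoothness\<close>

text \<open>The class of structures of a manifold contains the structure that generates it, so the charts of
the manifold cover it.\<close>

lemma Cr_manifold_charts:
  assumes "Cr_manifold r X \<S>"
  shows "c \<in> \<Union>\<S> \<Longrightarrow> is_chart X c"
    and "p \<in> topspace X \<Longrightarrow> \<exists>U \<phi>. (U, \<phi>) \<in> \<Union>\<S> \<and> p \<in> U"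
proof -
  have "\<S> \<in> {A. Cr_structure r X A} // Cr_equivalence r X"
    using assms by (simp add: Cr_manifold_def)
  then obtain A where A: "Cr_structure r X A" "\<S> = Cr_equivalence r X `` {A}"
    unfolding quotient_def by blast
  show "is_chart X c" if "c \<in> \<Union>\<S>"
  proof -
    from that obtain B where "c \<in> B" "B \<in> \<S>" by (rule UnionE)
    then have "Cr_structure r X B" unfolding A(2) by (simp add: Cr_equivalence_def)
    then show ?thesis using \<open>c \<in> B\<close> by (simp add: Cr_structure_def)
  qed
  have "A \<in> \<S>" using A(1) unfolding A(2) by (simp add: Cr_equivalence_def)
  moreover have "(\<Union>(U, \<phi>)\<in>A. U) = topspace X" using A(1) by (simp add: Cr_structure_def)
  ultimately show "\<exists>U \<phi>. (U, \<phi>) \<in> \<Union>\<S> \<and> p \<in> U" if p: "p \<in> topspace X"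
  proof -
    have "p \<in> (\<Union>(U, \<phi>)\<in>A. U)" using p \<open>(\<Union>(U, \<phi>)\<in>A. U) = topspace X\<close> by simp
    then obtain U \<phi> where "(U, \<phi>) \<in> A" "p \<in> U" by auto
    then show ?thesis using \<open>A \<in> \<S>\<close> by blast
  qed
qed

text \<open>From a point of the half-space one can move a little in each positive coordinate direction without
leaving it, and these directions determine the derivative.\<close>

lemma frechet_derivative_unique_within_half_space:
  fixes f :: "'e::euclidean_space \<Rightarrow> 'f::real_normed_vector"
  assumes C: "C = UNIV \<or> C = half_space" and L: "openin (top_of_set C) L" "x \<in> L"
    and "(f has_derivative f') (at x within L)" "(f has_derivative f'') (at x within L)"
  shows "f' = f''"
  using assms(4,5)
proof (rule frechet_derivative_unique_within)
  fix i :: 'e and e :: real assume i: "i \<in> Basis" and e: "e > 0"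
  obtain \<delta> where \<delta>: "\<delta> > 0" "ball x \<delta> \<inter> C \<subseteq> L"
    using L unfolding openin_contains_ball by blast
  have xC: "x \<in> C" using L openin_imp_subset by blast
  define d where "d = min e \<delta> / 2"
  have d: "0 < d" "d < e" "d < \<delta>" using e \<delta>(1) by (auto simp: d_def)
  have "0 \<le> e1 \<bullet> i" by (simp add: inner_Basis[OF e1_in_Basis i])
  then have "0 \<le> d * (e1 \<bullet> i)" using d(1) by simp
  moreover have "e1 \<bullet> x \<ge> 0" if "C = half_space" using xC unfolding that half_space_eq by simp
  ultimately have "x + d *\<^sub>R i \<in> C"
    using C unfolding half_space_eq by (auto simp: inner_add_right)
  moreover have "x + d *\<^sub>R i \<in> ball x \<delta>" using d i by (simp add: dist_norm)
  ultimately have "x + d *\<^sub>R i \<in> L" using \<delta>(2) by blast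
  then show "\<exists>d. 0 < \<bar>d\<bar> \<and> \<bar>d\<bar> < e \<and> x + d *\<^sub>R i \<in> L"
    using d by (intro exI[of _ d]) auto
qed

lemma openin_local_dom:
  assumes c: "is_chart X (U, \<phi>)" and d: "is_chart Y (V, \<psi>)" and cont: "continuous_map X Y f"
  shows "openin (top_of_set (\<phi> ` U)) (local_dom (topspace X) (U, \<phi>) (V, \<psi>) f)"
proof -
  have "openin X (U \<inter> topspace X)"
    using is_chartD(1)[OF c] by (intro openin_Int openin_topspace)
  then have "openin X {p \<in> U \<inter> topspace X. f p \<in> V}"
    using is_chartD(1)[OF d] by (rule openin_continuous_map_preimage_gen[OF cont])
  moreover have "{p \<in> U \<inter> topspace X. f p \<in> V} \<subseteq> U" by auto
  ultimately show ?thesis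
    unfolding local_dom_def using chart_open_image_iff[OF c] by simp
qed

lemma local_rep_chart:
  assumes "is_chart X (U, \<phi>)" "p \<in> U"
  shows "local_rep (U, \<phi>) (V, \<psi>) f (\<phi> p) = \<psi> (f p)"
  using inv_into_f_f[OF is_chartD(5)[OF assms(1)] assms(2)] by (simp add: local_rep_def)

text \<open>A left inverse \<open>h\<close> of the local expression of \<open>f\<close> near a point of maximal rank, defined and \<open>C\<^sup>r\<close> on an
open set of the ambient space. At a boundary point \<open>h\<close> comes from inverting an extension of the local
expression; it is the uniqueness of the derivative within the half-space that transfers the rank
condition to this extension.\<close>

lemma nondegenerate_local_inverse:
  fixes f :: "'a \<Rightarrow> 'b" and \<phi> :: "'a \<Rightarrow> 'e::euclidean_space" and \<psi> :: "'b \<Rightarrow> 'e"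
  assumes r: "1 \<le> r" and c: "is_chart X (U, \<phi>)" and d: "is_chart Y (V, \<psi>)"
    and cont: "continuous_map X Y f" and p: "p \<in> U" "f p \<in> V"
    and Cr: "Cr_on r (local_dom (topspace X) (U, \<phi>) (V, \<psi>) f) (local_rep (U, \<phi>) (V, \<psi>) f)"
    and rank: "dim (range (differential_in_charts X (U, \<phi>) (V, \<psi>) f p)) = DIM('e)"
  obtains N W h where "openin X N" "p \<in> N" "N \<subseteq> U" "f ` N \<subseteq> V"
    "open W" "\<psi> ` f ` N \<subseteq> W" "\<forall>k. enat k \<le> r \<longrightarrow> Ck_on_open k W h"
    "\<forall>q\<in>N. h (\<psi> (f q)) = \<phi> q"
proof -
  define L where "L = local_dom (topspace X) (U, \<phi>) (V, \<psi>) f"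
  define \<rho> where "\<rho> = local_rep (U, \<phi>) (V, \<psi>) f"
  define x where "x = \<phi> p"
  have oL: "openin (top_of_set (\<phi> ` U)) L"
    unfolding L_def by (rule openin_local_dom[OF c d cont])
  have "p \<in> topspace X" using p(1) is_chartD(2)[OF c] by blast
  then have xL: "x \<in> L" unfolding L_def x_def local_dom_def using p by auto
  obtain W g where W: "open W" "x \<in> W" "\<forall>y\<in>L \<inter> W. g y = \<rho> y"
      and Ck': "\<forall>k. enat k \<le> r \<longrightarrow> Ck_on_open k W g"
    using bspec[OF Cr[folded L_def \<rho>_def, unfolded Cr_on_def] xL] by (elim exE conjE)
  have Ck: "Ck_on_open k W g" if "enat k \<le> r" for k using Ck' that by simp
  have "Ck_on_open (Suc 0) W g"
    using Ck[of 1] r by (simp add: one_enat_def)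
  then have Dg: "(g has_derivative frechet_derivative g (at x)) (at x)"
    by (rule Ck_on_open_SucD(1)[OF _ W(2)])
  \<comment> \<open>the derivative of \<open>g\<close> at \<open>x\<close> is the differential of \<open>f\<close>, by uniqueness within \<open>L\<close>\<close>
  have "(\<rho> has_derivative frechet_derivative g (at x)) (at x within (L \<inter> W))"
    by (rule has_derivative_transform[OF _ _ has_derivative_at_withinI[OF Dg]]) (use xL W(2,3) in simp_all)
  moreover have "at x within (L \<inter> W) = at x within L"
    by (rule at_within_nhd[OF W(2,1)]) auto
  ultimately have D\<rho>: "(\<rho> has_derivative frechet_derivative g (at x)) (at x within L)"
    by simp
  then have "\<rho> differentiable (at x within L)" unfolding differentiable_def by blast
  then have "(\<rho> has_derivative frechet_derivative \<rho> (at x within L)) (at x within L)"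
    unfolding frechet_derivative_works .
  from frechet_derivative_unique_within_half_space[OF is_chartD(3)[OF c] oL xL D\<rho> this]
  have "frechet_derivative g (at x) = differential_in_charts X (U, \<phi>) (V, \<psi>) f p"
    unfolding differential_in_charts_def L_def \<rho>_def x_def by simp
  then have "dim (range (frechet_derivative g (at x))) = DIM('e)" using rank by simp
  then have "span (range (frechet_derivative g (at x))) = UNIV"
    unfolding dim_eq_full .
  moreover have "subspace (range (frechet_derivative g (at x)))"
    using has_derivative_linear[OF Dg] subspace_UNIV by (rule linear_subspace_image)
  then have "span (range (frechet_derivative g (at x))) = range (frechet_derivative g (at x))"
    by (rule span_eq_iff[THEN iffD2])
  ultimately have surj: "surj (frechet_derivative g (at x))"
    by simp
  obtain U' W' h where UW: "open U'" "U' \<subseteq> W" "x \<in> U'" "open W'" "homeomorphism U' W' g h"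
    and h: "\<forall>k. enat k \<le> r \<longrightarrow> Ck_on_open k W' h"
    by (rule Cr_inverse_function[OF r W(1,2) Ck surj])
  define N where "N = {q\<in>U. \<phi> q \<in> L \<inter> U'}"
  have oN: "openin X N"
    unfolding N_def by (rule chart_preimage[OF c]) (intro openin_Int_open oL UW(1))
  have N: "q \<in> U \<and> f q \<in> V \<and> g (\<phi> q) = \<psi> (f q) \<and> \<phi> q \<in> U'" if q: "q \<in> N" for q
  proof -
    have qU: "q \<in> U" "\<phi> q \<in> L" "\<phi> q \<in> U'" using q by (auto simp: N_def)
    then obtain q' where "q' \<in> U" "f q' \<in> V" "\<phi> q = \<phi> q'" unfolding L_def local_dom_def by auto
    then have "f q \<in> V" using inj_onD[OF is_chartD(5)[OF c], of q q'] qU(1) by simp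
    moreover have "g (\<phi> q) = \<rho> (\<phi> q)" by (rule bspec[OF W(3)]) (use qU(2,3) UW(2) in auto)
    ultimately show ?thesis using qU local_rep_chart[OF c qU(1)] by (simp add: \<rho>_def)
  qed
  show thesis
  proof (rule that[OF oN _ _ _ UW(4) _ h])
    show "p \<in> N" using p(1) xL UW(3) by (simp add: N_def x_def)
    show "N \<subseteq> U" "f ` N \<subseteq> V" using N by auto
    have "\<psi> (f q) \<in> W'" "h (\<psi> (f q)) = \<phi> q" if "q \<in> N" for q
    proof -
      have q: "\<phi> q \<in> U'" "g (\<phi> q) = \<psi> (f q)" using N[OF that] by simp_all
      show "\<psi> (f q) \<in> W'"
        unfolding q(2)[symmetric] homeomorphism_image1[OF UW(5), symmetric] using q(1) by (rule imageI)
      show "h (\<psi> (f q)) = \<phi> q"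
        unfolding q(2)[symmetric] using UW(5) q(1) by (rule homeomorphism_apply1)
    qed
    then show "\<psi> ` f ` N \<subseteq> W'" "\<forall>q\<in>N. h (\<psi> (f q)) = \<phi> q" by auto
  qed
qed

lemma Cr_on_subset: "Cr_on r S g \<Longrightarrow> T \<subseteq> S \<Longrightarrow> Cr_on r T g"
  unfolding Cr_on_def
proof (rule ballI)
  fix x assume H: "\<forall>x\<in>S. \<exists>W h. open W \<and> x \<in> W \<and> (\<forall>y\<in>S \<inter> W. h y = g y) \<and>
      (\<forall>k. enat k \<le> r \<longrightarrow> Ck_on_open k W h)" and T: "T \<subseteq> S" "x \<in> T"
  obtain W h where W: "open W" "x \<in> W" "\<forall>y\<in>S \<inter> W. h y = g y" "\<forall>k. enat k \<le> r \<longrightarrow> Ck_on_open k W h"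
    using bspec[OF H subsetD[OF T]] by (elim exE conjE)
  then show "\<exists>W h. open W \<and> x \<in> W \<and> (\<forall>y\<in>T \<inter> W. h y = g y) \<and> (\<forall>k. enat k \<le> r \<longrightarrow> Ck_on_open k W h)"
    using T(1) by (intro exI[of _ W] exI[of _ h] conjI) auto
qed

lemma nondegenerate_locally_inj:
  fixes \<S> :: "('a, 'e::euclidean_space) chart set set" and \<T> :: "('b, 'e) chart set set"
  assumes r: "1 \<le> r" and X: "Cr_manifold r X \<S>" and Y: "Cr_manifold r Y \<T>"
    and f: "Cr_mapping r X \<S> Y \<T> f" and p: "p \<in> topspace X" "nondegenerate_at X \<S> \<T> f p"
  shows "\<exists>N. openin X N \<and> p \<in> N \<and> inj_on f N"
proof -
  have cont: "continuous_map X Y f" using f by (simp add: Cr_mapping_def)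
  then have fp: "f p \<in> topspace Y" using p(1) continuous_map_image_subset_topspace by blast
  obtain U \<phi> where c: "(U, \<phi>) \<in> \<Union>\<S>" "p \<in> U" using Cr_manifold_charts(2)[OF X p(1)] by (elim exE conjE)
  obtain V \<psi> where d: "(V, \<psi>) \<in> \<Union>\<T>" "f p \<in> V" using Cr_manifold_charts(2)[OF Y fp] by (elim exE conjE)
  note cc = Cr_manifold_charts(1)[OF X c(1)] and dc = Cr_manifold_charts(1)[OF Y d(1)]
  have "Cr_on r (local_dom (topspace X) (U, \<phi>) (V, \<psi>) f) (local_rep (U, \<phi>) (V, \<psi>) f)"
    by (rule f[unfolded Cr_mapping_def, THEN conjunct2, rule_format, OF c(1) d(1)])
  moreover have "dim (range (differential_in_charts X (U, \<phi>) (V, \<psi>) f p)) = DIM('e)"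
    using p(2) c d unfolding nondegenerate_at_def by auto
  ultimately obtain N W h where N: "openin X N" "p \<in> N" "N \<subseteq> U" "\<forall>q\<in>N. h (\<psi> (f q)) = \<phi> q"
    by (rule nondegenerate_local_inverse[OF r cc dc cont c(2) d(2)])
  have "inj_on f N"
  proof (rule inj_onI)
    fix a b assume ab: "a \<in> N" "b \<in> N" "f a = f b"
    have "\<phi> a = \<phi> b" using bspec[OF N(4) ab(1)] bspec[OF N(4) ab(2)] ab(3) by simp
    then show "a = b" using inj_onD[OF is_chartD(5)[OF cc], of a b] N(3) ab(1,2) by blast
  qed
  then show ?thesis using N(1,2) by blast
qed

text \<open>For the interior and for the whole manifold at once: \<open>A\<close> is any set of points of maximal rank. The
left inverse \<open>h\<close> obtained near a point \<open>p\<close> satisfies \<open>h (\<psi> (f q)) = \<phi> q\<close> only for \<open>q\<close> near \<open>p\<close>; since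
\<open>f\<close> is open, all points near \<open>f p\<close> are of the form \<open>f q\<close> with such \<open>q\<close>, and so \<open>h\<close> extends the local
expression of the inverse of \<open>f\<close>.\<close>

lemma nondegenerate_homeomorphic_imp_Cr_diffeomorphism:
  fixes \<S> :: "('a, 'e::euclidean_space) chart set set" and \<T> :: "('b, 'e) chart set set"
  assumes r: "1 \<le> r" and X: "Cr_manifold r X \<S>" and Y: "Cr_manifold r Y \<T>"
    and f: "Cr_mapping r X \<S> Y \<T> f" and hom: "homeomorphic_map X Y f"
    and A: "A \<subseteq> topspace X" and nd: "\<And>p. p \<in> A \<Longrightarrow> nondegenerate_at X \<S> \<T> f p"
  shows "Cr_diffeomorphism r (subtopology X A) \<S> (subtopology Y (f ` A)) \<T> f"
proof -
  have cont: "continuous_map X Y f" using f by (simp add: Cr_mapping_def)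
  have inj: "inj_on f (topspace X)" using hom by (rule homeomorphic_imp_injective_map)
  then have injA: "inj_on f A" using A by (rule inj_on_subset)
  have opn: "openin Y (f ` N)" if "openin X N" for N
    using homeomorphic_imp_open_map[OF hom] that by (simp add: open_map_def)
  have fA: "f ` A \<subseteq> topspace Y"
    using A cont continuous_map_image_subset_topspace by blast
  have top: "topspace (subtopology X A) = A" "topspace (subtopology Y (f ` A)) = f ` A"
    using A fA by auto
  have homA: "homeomorphic_map (subtopology X A) (subtopology Y (f ` A)) f"
    by (rule homeomorphic_map_subtopologies[OF hom]) (use A fA in \<open>simp add: Int_absorb1\<close>)
  have CrX: "Cr_on r (local_dom (topspace X) c d f) (local_rep c d f)" if "c \<in> \<Union>\<S>" "d \<in> \<Union>\<T>" for c d
    by (rule f[unfolded Cr_mapping_def, THEN conjunct2, rule_format, OF that])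
  have "Cr_mapping r (subtopology X A) \<S> (subtopology Y (f ` A)) \<T> f"
    unfolding Cr_mapping_def
  proof (intro conjI ballI)
    show "continuous_map (subtopology X A) (subtopology Y (f ` A)) f"
      using homA by (rule homeomorphic_imp_continuous_map)
    fix c d assume cd: "c \<in> \<Union>\<S>" "d \<in> \<Union>\<T>"
    have "local_dom (topspace (subtopology X A)) c d f \<subseteq> local_dom (topspace X) c d f"
      unfolding top local_dom_def using A by (auto split: prod.splits)
    then show "Cr_on r (local_dom (topspace (subtopology X A)) c d f) (local_rep c d f)"
      by (rule Cr_on_subset[OF CrX[OF cd]])
  qed
  moreover have "Cr_mapping r (subtopology Y (f ` A)) \<T> (subtopology X A) \<S> (inv_into A f)"
    unfolding Cr_mapping_def
  proof (intro conjI ballI)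
    show "continuous_map (subtopology Y (f ` A)) (subtopology X A) (inv_into A f)"
      using homeomorphic_imp_continuous_map[OF homeomorphic_map_inv_into[OF homA]] unfolding top .
    fix d c assume dT: "d \<in> \<Union>\<T>" and cS: "c \<in> \<Union>\<S>"
    obtain V \<psi> where d: "d = (V, \<psi>)" by (rule prod.exhaust)
    obtain U \<phi> where c: "c = (U, \<phi>)" by (rule prod.exhaust)
    note dc = Cr_manifold_charts(1)[OF Y dT, unfolded d] and cc = Cr_manifold_charts(1)[OF X cS, unfolded c]
    show "Cr_on r (local_dom (topspace (subtopology Y (f ` A))) d c (inv_into A f)) (local_rep d c (inv_into A f))"
      unfolding Cr_on_def top
    proof (rule ballI)
      fix z assume "z \<in> local_dom (f ` A) d c (inv_into A f)"
      then obtain y where y: "z = \<psi> y" "y \<in> V" "y \<in> f ` A" "inv_into A f y \<in> U"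
        unfolding d c local_dom_def by auto
      define p where "p = inv_into A f y"
      have p: "p \<in> A" "f p = y" "p \<in> U" "f p \<in> V"
        using y inv_into_into[OF y(3)] f_inv_into_f[OF y(3)] by (simp_all add: p_def)
      have "dim (range (differential_in_charts X (U, \<phi>) (V, \<psi>) f p)) = DIM('e)"
        using nd[OF p(1)] dT cS p(3,4) unfolding d c nondegenerate_at_def by auto
      from nondegenerate_local_inverse[OF r cc dc cont p(3,4) CrX[OF cS dT, unfolded c d] this]
      obtain N W h where N: "openin X N" "p \<in> N" "N \<subseteq> U" "f ` N \<subseteq> V"
        and W: "open W" "\<psi> ` f ` N \<subseteq> W" and h: "\<forall>k. enat k \<le> r \<longrightarrow> Ck_on_open k W h"
        "\<forall>q\<in>N. h (\<psi> (f q)) = \<phi> q" .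
      have "openin (top_of_set (\<psi> ` V)) (\<psi> ` f ` N)"
        using chart_open_image_iff[OF dc N(4)] opn[OF N(1)] by simp
      then obtain W0 where W0: "open W0" "\<psi> ` f ` N = \<psi> ` V \<inter> W0"
        unfolding openin_open by blast
      have "h z' = local_rep d c (inv_into A f) z'"
        if z': "z' \<in> local_dom (f ` A) d c (inv_into A f) \<inter> (W \<inter> W0)" for z'
      proof -
        obtain y' where y': "z' = \<psi> y'" "y' \<in> V" "y' \<in> f ` A"
          using z' unfolding d c local_dom_def by auto
        have "z' \<in> \<psi> ` f ` N" unfolding W0(2) using y'(1,2) z' by auto
        then obtain q where q: "q \<in> N" "z' = \<psi> (f q)" by auto
        have fq: "y' = f q"
          using inj_onD[OF is_chartD(5)[OF dc], of y' "f q"] y'(1,2) q N(4) by auto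
        obtain a where a: "a \<in> A" "y' = f a" using y'(3) by auto
        have "a = q"
          using inj_onD[OF inj, of a q] a fq A q(1) openin_subset[OF N(1)] by auto
        then have inv: "inv_into A f (f q) = q" using inv_into_f_f[OF injA a(1)] by simp
        have "local_rep d c (inv_into A f) z' = \<phi> (inv_into A f (f q))"
          unfolding y'(1) d c using local_rep_chart[OF dc y'(2)] fq by simp
        then show ?thesis using inv bspec[OF h(2) q(1)] q(2) by simp
      qed
      moreover have "z \<in> W \<inter> W0"
      proof -
        have "z \<in> \<psi> ` f ` N" unfolding y(1) p(2)[symmetric] using N(2) by (intro imageI)
        then show ?thesis using W(2) W0(2) by blast
      qed
      moreover have "Ck_on_open k (W \<inter> W0) h" if "enat k \<le> r" for k
        using h(1)[rule_format, OF that] by (rule Ck_on_open_subset) simp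
      ultimately show "\<exists>W g. open W \<and> z \<in> W \<and>
          (\<forall>y\<in>local_dom (f ` A) d c (inv_into A f) \<inter> W. g y = local_rep d c (inv_into A f) y) \<and>
          (\<forall>k. enat k \<le> r \<longrightarrow> Ck_on_open k W g)"
        using W(1) W0(1) by (intro exI[of _ "W \<inter> W0"] exI[of _ h]) auto
    qed
  qed
  moreover have "bij_betw f A (f ` A)" using injA by (rule inj_on_imp_bij_betw)
  ultimately show ?thesis unfolding Cr_diffeomorphism_def top by blast
qed

theorem theorem2p3:
  fixes r :: enat
    and X :: "'a topology" and \<S> :: "('a, 'e::euclidean_space) chart set set"
    and Y :: "'b topology" and \<T> :: "('b, 'e) chart set set"
    and f :: "'a \<Rightarrow> 'b"
  assumes "r \<ge> 1"
    and "Cr_manifold r X \<S>" and "connected_space X" and "compact_space X"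
    and "manifold_boundary TYPE('e) X \<noteq> {}"
    and "Cr_manifold r Y \<T>" and "connected_space Y"
    and "manifold_boundary TYPE('e) Y \<noteq> {}"
    and "Cr_mapping r X \<S> Y \<T> f"
    and "\<forall>p\<in>manifold_interior TYPE('e) X. nondegenerate_at X \<S> \<T> f p"
    and "f ` manifold_boundary TYPE('e) X \<subseteq> manifold_boundary TYPE('e) Y"
    and "inj_on f (manifold_boundary TYPE('e) X)"
  shows "homeomorphic_map X Y f \<and>
    Cr_diffeomorphism r
      (subtopology X (manifold_interior TYPE('e) X)) \<S>
      (subtopology Y (manifold_interior TYPE('e) Y)) \<T> f \<and>
    ((\<forall>p\<in>topspace X. nondegenerate_at X \<S> \<T> f p) \<longrightarrow> Cr_diffeomorphism r X \<S> Y \<T> f)"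
proof -
  let ?IX = "manifold_interior TYPE('e) X" and ?IY = "manifold_interior TYPE('e) Y"
  have X: "topological_manifold TYPE('e) X" and Y: "topological_manifold TYPE('e) Y"
    using assms(2,6) by (simp_all add: Cr_manifold_def)
  have cont: "continuous_map X Y f" using assms(9) by (simp add: Cr_mapping_def)
  have loc: "\<exists>N. openin X N \<and> p \<in> N \<and> inj_on f N" if "p \<in> ?IX" for p
    using subsetD[OF manifold_interior_subset that] bspec[OF assms(10) that]
    by (rule nondegenerate_locally_inj[OF assms(1,2,6,9)])
  have hom: "homeomorphic_map X Y f"
    by (rule locally_injective_imp_homeomorphic_map(1)[OF X Y assms(4,7,5) cont loc assms(11,12)])
  have im: "f ` ?IX = ?IY"
    by (rule locally_injective_imp_homeomorphic_map(2)[OF X Y assms(4,7,5) cont loc assms(11,12)])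
  note diffeo = nondegenerate_homeomorphic_imp_Cr_diffeomorphism[OF assms(1,2,6,9) hom]
  have "Cr_diffeomorphism r (subtopology X ?IX) \<S> (subtopology Y (f ` ?IX)) \<T> f"
    using assms(10) by (intro diffeo manifold_interior_subset) auto
  moreover have "Cr_diffeomorphism r X \<S> Y \<T> f" if "\<forall>p\<in>topspace X. nondegenerate_at X \<S> \<T> f p"
  proof -
    have "Cr_diffeomorphism r (subtopology X (topspace X)) \<S> (subtopology Y (f ` topspace X)) \<T> f"
      using that by (intro diffeo) auto
    then show ?thesis
      unfolding homeomorphic_imp_surjective_map[OF hom] by simp
  qed
  ultimately show ?thesis using hom unfolding im by blast
qed

end
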